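(* Let $u(t)=S(t)u_0-\mathrm{i}\int_0^tS(t-r)\,\mathrm{d}W(r)$ be the mild solution of the linear stochastic Schr\"odinger equation $\mathrm{i}\,\mathrm{d}u-\Delta u\,\mathrm{d}t=\mathrm{d}W$ on $\mathbb{R}^d\times(0,\infty)$, $u(0)=u_0$, where $u_0$ is $\mathcal{F}_0$-measurable and $W$ is a $Q$-Wiener process. Let $M(u)=\int_{\mathbb{R}^d}|u|^2\,\mathrm{d}x$. Assume that $\mathbb{E}[M(u_0)]$ is finite and that the covariance operator $Q$ is trace-class. Then $$\mathbb{E}[M(u(t))]=\mathbb{E}[\|u(t)\|_{L^2}^2]=\mathbb{E}[M(u_0)]+t\,\mathrm{Tr}(Q)\qquad\text{for all } t\ge0.$$
   Context: $d\ge1$ is arbitrary. $L^2=L^2(\mathbb{R}^d)$ is the space of complex-valued square integrable functions, with inner product $(u,v)=\mathrm{Re}\int_{\mathbb{R}^d}u\bar v\,\mathrm{d}x$. $S(t)=\mathrm{e}^{-\mathrm{i}t\Delta}$ is the unitary group generated by $-\mathrm{i}\Delta$. $(\Omega,\mathcal{F},\mathbb{P},\{\mathcal{F}_t\}_{t\ge0})$ is a filtered probability space with a normal filtration; $Q$ is a nonnegative self-adjoint operator on $L^2$, and $W$ is a complex-valued (i.e. $L^2$-valued), square integrable $Q$-Wiener process with respect to $\{\mathcal{F}_t\}$, so $W(t)=\sum_j\beta_j(t)Q^{1/2}e_j$ for an orthonormal basis $(e_j)$ of $L^2$ and independent standard real Brownian motions $\beta_j$. $\mathrm{Tr}(Q)=\sum_j\|Q^{1/2}e_j\|_{L^2}^2$.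 *)

theory Defs
  imports "HOL-Probability.Probability"
begin

section \<open>The Hilbert space \<open>L\<^sup>2(\<real>\<^sup>d; \<complex>)\<close>\<close>

text \<open>Vectors in \<open>\<real>\<^sup>d\<close> are \<open>real ^ 'n\<close> with \<open>d = CARD('n)\<close>. Elements of \<open>'n l2\<close> are a.e.-classes of Borel
  functions; every a.e.-class of Lebesgue measurable functions contains a Borel function.\<close>

definition square_integrable :: "(real ^ 'n \<Rightarrow> complex) \<Rightarrow> bool" where
  "square_integrable f \<longleftrightarrow>
     f \<in> borel_measurable lborel \<and> integrable lborel (\<lambda>x. (cmod (f x))\<^sup>2)"

definition l2_rel :: "(real ^ 'n \<Rightarrow> complex) \<Rightarrow> (real ^ 'n \<Rightarrow> complex) \<Rightarrow> bool" where
  "l2_rel f g \<longleftrightarrow> square_integrable f \<and> square_integrable g \<and> (AE x in lborel. f x = g x)"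

lemma square_integrable_zero: "square_integrable (\<lambda>x. 0)"
  by (simp add: square_integrable_def)

quotient_type (overloaded) 'n l2 = "real ^ ('n::finite) \<Rightarrow> complex" / partial: l2_rel
proof (rule part_equivpI)
  show "\<exists>f::real ^ 'n \<Rightarrow> complex. l2_rel f f"
    using square_integrable_zero by (auto simp: l2_rel_def intro!: exI[of _ "\<lambda>x. 0"])
  show "symp (l2_rel :: (real ^ 'n \<Rightarrow> complex) \<Rightarrow> _)"
    by (auto simp: symp_def l2_rel_def elim: eventually_mono)
  show "transp (l2_rel :: (real ^ 'n \<Rightarrow> complex) \<Rightarrow> _)"
    unfolding transp_def l2_rel_def by (auto elim: eventually_elim2)
qed

lemma borel_measurable_cnj' [measurable (raw)]:
  "f \<in> borel_measurable N \<Longrightarrow> (\<lambda>x. cnj (f x)) \<in> borel_measurable N"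
  by (rule measurable_compose[OF _ borel_measurable_continuous_onI]) (auto intro!: continuous_intros)

lemma square_integrable_add:
  assumes "square_integrable f" "square_integrable g"
  shows "square_integrable (\<lambda>x. f x + g x)"
proof -
  have [measurable]: "f \<in> borel_measurable lborel" "g \<in> borel_measurable lborel"
    using assms by (auto simp: square_integrable_def)
  have bound: "(cmod (f x + g x))\<^sup>2 \<le> 2 * (cmod (f x))\<^sup>2 + 2 * (cmod (g x))\<^sup>2" for x
  proof -
    have "(cmod (f x + g x))\<^sup>2 \<le> (cmod (f x) + cmod (g x))\<^sup>2"
      by (intro power_mono norm_triangle_ineq) auto
    also have "\<dots> \<le> 2 * (cmod (f x))\<^sup>2 + 2 * (cmod (g x))\<^sup>2"
      using zero_le_power2[of "cmod (f x) - cmod (g x)"] by (simp add: power2_eq_square algebra_simps)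
    finally show ?thesis .
  qed
  have "integrable lborel (\<lambda>x. 2 * (cmod (f x))\<^sup>2 + 2 * (cmod (g x))\<^sup>2)"
    using assms by (auto simp: square_integrable_def)
  then have "integrable lborel (\<lambda>x. (cmod (f x + g x))\<^sup>2)"
    by (rule Bochner_Integration.integrable_bound) (use bound in \<open>auto intro!: AE_I2\<close>)
  then show ?thesis by (simp add: square_integrable_def)
qed

lemma square_integrable_mult:
  assumes "square_integrable f"
  shows "square_integrable (\<lambda>x. c * f x)"
  using assms by (auto simp: square_integrable_def norm_mult power_mult_distrib)

lemma integrable_inner_l2:
  assumes "square_integrable f" "square_integrable g"
  shows "integrable lborel (\<lambda>x. f x * cnj (g x))"
proof -
  have [measurable]: "f \<in> borel_measurable lborel" "g \<in> borel_measurable lborel"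
    using assms by (auto simp: square_integrable_def)
  have bound: "cmod (f x) * cmod (g x) \<le> (cmod (f x))\<^sup>2 + (cmod (g x))\<^sup>2" for x
    using zero_le_power2[of "cmod (f x) - cmod (g x)"] zero_le_power2[of "cmod (f x)"]
      zero_le_power2[of "cmod (g x)"]
    by (simp add: power2_eq_square algebra_simps) (smt (verit) mult_nonneg_nonneg norm_ge_zero)
  have "integrable lborel (\<lambda>x. (cmod (f x))\<^sup>2 + (cmod (g x))\<^sup>2)"
    using assms by (auto simp: square_integrable_def)
  then show ?thesis
    by (rule Bochner_Integration.integrable_bound) (use bound in \<open>auto intro!: AE_I2 simp: norm_mult\<close>)
qed

instantiation l2 :: (finite) real_vector
begin

lift_definition zero_l2 :: "'a l2" is "\<lambda>x. 0"
  by (simp add: l2_rel_def square_integrable_zero)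

lift_definition plus_l2 :: "'a l2 \<Rightarrow> 'a l2 \<Rightarrow> 'a l2" is "\<lambda>f g x. f x + g x"
  by (auto simp: l2_rel_def square_integrable_add elim: eventually_elim2)

lift_definition uminus_l2 :: "'a l2 \<Rightarrow> 'a l2" is "\<lambda>f x. - f x"
  by (auto simp: l2_rel_def square_integrable_def elim: eventually_mono)

definition minus_l2 :: "'a l2 \<Rightarrow> 'a l2 \<Rightarrow> 'a l2" where
  "u - v = u + - (v :: 'a l2)"

lift_definition scaleR_l2 :: "real \<Rightarrow> 'a l2 \<Rightarrow> 'a l2" is "\<lambda>c f x. complex_of_real c * f x"
  by (auto simp: l2_rel_def square_integrable_mult elim: eventually_mono)

instance
proof
  fix u v w :: "'a l2" and a b :: real
  show "u + v + w = u + (v + w)"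
    by transfer (auto simp: l2_rel_def add.assoc intro!: square_integrable_add)
  show "u + v = v + u"
    by transfer (auto simp: l2_rel_def add.commute intro!: square_integrable_add)
  show "0 + u = u" by transfer (auto simp: l2_rel_def)
  show "- u + u = 0" by transfer (auto simp: l2_rel_def square_integrable_zero)
  show "u - v = u + - v" by (simp add: minus_l2_def)
  show "a *\<^sub>R (u + v) = a *\<^sub>R u + a *\<^sub>R v"
    by transfer
      (auto simp: l2_rel_def distrib_left intro!: square_integrable_add square_integrable_mult)
  show "(a + b) *\<^sub>R u = a *\<^sub>R u + b *\<^sub>R u"
    by transfer (auto simp: l2_rel_def distrib_right square_integrable_add square_integrable_mult
        simp del: of_real_add simp flip: distrib_right, auto simp: distrib_right square_integrable_mult
        simp flip: of_real_add)
  show "a *\<^sub>R b *\<^sub>R u = (a * b) *\<^sub>R u"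
    by transfer (auto simp: l2_rel_def mult.assoc intro!: square_integrable_mult)
  show "1 *\<^sub>R u = u" by transfer (auto simp: l2_rel_def)
qed

end

instantiation l2 :: (finite) real_inner
begin

lift_definition inner_l2 :: "'a l2 \<Rightarrow> 'a l2 \<Rightarrow> real" is
  "\<lambda>f g. Re (LINT x|lborel. f x * cnj (g x))"
  unfolding l2_rel_def
  by (intro arg_cong[where f = Re] integral_cong_AE)
    (auto simp: square_integrable_def elim: eventually_elim2)

definition norm_l2 :: "'a l2 \<Rightarrow> real" where "norm_l2 u = sqrt (inner u u)"
definition dist_l2 :: "'a l2 \<Rightarrow> 'a l2 \<Rightarrow> real" where "dist_l2 u v = norm (u - v)"
definition sgn_l2 :: "'a l2 \<Rightarrow> 'a l2" where "sgn_l2 u = u /\<^sub>R norm u"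
definition uniformity_l2 :: "('a l2 \<times> 'a l2) filter" where
  "uniformity_l2 = (INF e\<in>{0<..}. principal {(x, y). dist x y < e})"
definition open_l2 :: "'a l2 set \<Rightarrow> bool" where
  "open_l2 U = (\<forall>x\<in>U. eventually (\<lambda>(x', y). x' = x \<longrightarrow> y \<in> U) uniformity)"

instance
proof
  fix u v w :: "'a l2" and a :: real
  show "dist u v = norm (u - v)" by (simp add: dist_l2_def)
  show "sgn u = u /\<^sub>R norm u" by (simp add: sgn_l2_def)
  show "norm u = sqrt (inner u u)" by (simp add: norm_l2_def)
  show "inner u v = inner v u"
  proof transfer
    fix f g :: "real ^ 'a \<Rightarrow> complex"
    have "(LINT x|lborel. g x * cnj (f x)) = cnj (LINT x|lborel. f x * cnj (g x))"
      using Bochner_Integration.integral_cnj[of lborel "\<lambda>x. f x * cnj (g x)"] by (simp add: mult.commute del: Bochner_Integration.integral_cnj)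
    then show "Re (LINT x|lborel. f x * cnj (g x)) = Re (LINT x|lborel. g x * cnj (f x))" by simp
  qed
  show "inner (u + v) w = inner u w + inner v w"
    by transfer (simp add: l2_rel_def distrib_right integrable_inner_l2)
  show "inner (a *\<^sub>R u) v = a * inner u v"
    by transfer (simp add: mult.assoc)
  have sq: "Re (LINT x|lborel. f x * cnj (f x)) = (LINT x|lborel. (cmod (f x))\<^sup>2)"
    for f :: "real ^ 'a \<Rightarrow> complex"
    by (simp flip: complex_norm_square add: integral_complex_of_real del: of_real_power)
  show "0 \<le> inner u u" by transfer (simp add: sq)
  show "inner u u = 0 \<longleftrightarrow> u = 0"
  proof transfer
    fix f :: "real ^ 'a \<Rightarrow> complex"
    assume f: "l2_rel f f"
    then have "(LINT x|lborel. (cmod (f x))\<^sup>2) = 0 \<longleftrightarrow> (AE x in lborel. (cmod (f x))\<^sup>2 = 0)"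
      by (intro integral_nonneg_eq_0_iff_AE) (auto simp: l2_rel_def square_integrable_def)
    then show "Re (LINT x|lborel. f x * cnj (f x)) = 0 \<longleftrightarrow> l2_rel f (\<lambda>x. 0)"
      using f by (simp add: sq l2_rel_def square_integrable_zero)
  qed
qed (simp_all add: uniformity_l2_def open_l2_def)

end

lift_definition scaleC :: "complex \<Rightarrow> 'n::finite l2 \<Rightarrow> 'n l2" (infixr "*\<^sub>C" 75) is "\<lambda>c f x. c * f x"
  by (auto simp: l2_rel_def square_integrable_mult elim: eventually_mono)

lift_definition mass :: "'n::finite l2 \<Rightarrow> real" is "\<lambda>f. LINT x|lborel. (cmod (f x))\<^sup>2"
  unfolding l2_rel_def
  by (intro integral_cong_AE) (auto simp: square_integrable_def elim: eventually_mono)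


section \<open>The unitary group generated by \<open>-\<i>\<Delta>\<close>\<close>

definition partial_deriv :: "'n::finite \<Rightarrow> (real ^ 'n \<Rightarrow> complex) \<Rightarrow> real ^ 'n \<Rightarrow> complex" where
  "partial_deriv i f x = frechet_derivative f (at x) (axis i 1)"

text \<open>Being coinductive, \<open>smooth f\<close> says that all iterated partial derivatives of \<open>f\<close> exist and are
  differentiable, i.e. that \<open>f\<close> is of class \<open>C\<^sup>\<infinity>\<close>.\<close>

coinductive smooth :: "(real ^ 'n::finite \<Rightarrow> complex) \<Rightarrow> bool" where
  "(\<And>x. f differentiable (at x)) \<Longrightarrow> (\<And>i. smooth (partial_deriv i f)) \<Longrightarrow> smooth f"

definition test_function :: "(real ^ 'n::finite \<Rightarrow> complex) \<Rightarrow> bool" where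
  "test_function \<phi> \<longleftrightarrow> smooth \<phi> \<and> compact (closure {x. \<phi> x \<noteq> 0})"

definition laplacian :: "(real ^ 'n::finite \<Rightarrow> complex) \<Rightarrow> real ^ 'n \<Rightarrow> complex" where
  "laplacian \<phi> x = (\<Sum>i\<in>UNIV. partial_deriv i (partial_deriv i \<phi>) x)"

lemma smooth_imp_measurable: "smooth \<phi> \<Longrightarrow> \<phi> \<in> borel_measurable borel"
  by (intro borel_measurable_continuous_onI differentiable_imp_continuous_on)
    (auto simp: differentiable_on_def elim!: smooth.cases intro: differentiable_at_withinI)

lemma test_function_imp_measurable:
  assumes "test_function \<phi>"
  shows "\<phi> \<in> borel_measurable borel" "laplacian \<phi> \<in> borel_measurable borel"
proof -
  have "smooth \<phi>" using assms by (simp add: test_function_def)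
  moreover have "smooth (partial_deriv i f)" if "smooth f" for i and f :: "real ^ 'a \<Rightarrow> complex"
    using that by (auto elim: smooth.cases)
  ultimately have "smooth \<phi>" "smooth (partial_deriv i (partial_deriv i \<phi>))" for i by auto
  then have "\<phi> \<in> borel_measurable borel" "partial_deriv i (partial_deriv i \<phi>) \<in> borel_measurable borel" for i
    by (auto intro: smooth_imp_measurable)
  then show "\<phi> \<in> borel_measurable borel" "laplacian \<phi> \<in> borel_measurable borel"
    unfolding laplacian_def[abs_def] by (auto intro: borel_measurable_sum)
qed

lift_definition has_weak_laplacian :: "'n::finite l2 \<Rightarrow> 'n l2 \<Rightarrow> bool" is
  "\<lambda>f g. \<forall>\<phi>. test_function \<phi> \<longrightarrow>
     (LINT x|lborel. f x * laplacian \<phi> x) = (LINT x|lborel. g x * \<phi> x)"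
proof -
  fix f f' g g' :: "real ^ 'n \<Rightarrow> complex"
  assume ff': "l2_rel f f'" and gg': "l2_rel g g'"
  have "(LINT x|lborel. f x * laplacian \<phi> x) = (LINT x|lborel. f' x * laplacian \<phi> x)"
    "(LINT x|lborel. g x * \<phi> x) = (LINT x|lborel. g' x * \<phi> x)" if "test_function \<phi>" for \<phi>
    using ff' gg' test_function_imp_measurable[OF that]
    by (intro integral_cong_AE; auto simp: l2_rel_def square_integrable_def elim: eventually_mono)+
  then show "(\<forall>\<phi>. test_function \<phi> \<longrightarrow>
      (LINT x|lborel. f x * laplacian \<phi> x) = (LINT x|lborel. g x * \<phi> x)) \<longleftrightarrow>
    (\<forall>\<phi>. test_function \<phi> \<longrightarrow>
      (LINT x|lborel. f' x * laplacian \<phi> x) = (LINT x|lborel. g' x * \<phi> x))"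
    by auto
qed

text \<open>Unbounded operators are given by their graphs. The domain of the Laplacian consists of all \<open>u\<close> in
  \<open>L\<^sup>2\<close> whose distributional Laplacian is in \<open>L\<^sup>2\<close>, which is \<open>H\<^sup>2\<close>.\<close>

definition minus_i_laplacian :: "('n::finite l2 \<times> 'n l2) set" where
  "minus_i_laplacian = {(u, - \<i> *\<^sub>C v) | u v. has_weak_laplacian u v}"

definition unitary_group :: "(real \<Rightarrow> 'n::finite l2 \<Rightarrow>\<^sub>L 'n l2) \<Rightarrow> bool" where
  "unitary_group S \<longleftrightarrow>
     (\<forall>t. surj (S t) \<and> (\<forall>u v. inner (S t u) (S t v) = inner u v) \<and>
          (\<forall>c u. S t (c *\<^sub>C u) = c *\<^sub>C S t u)) \<and>
     S 0 = id_blinfun \<and> (\<forall>s t. S (s + t) = S s o\<^sub>L S t) \<and>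
     (\<forall>u. continuous_on UNIV (\<lambda>t. S t u))"

definition generator :: "(real \<Rightarrow> 'n::finite l2 \<Rightarrow>\<^sub>L 'n l2) \<Rightarrow> ('n l2 \<times> 'n l2) set" where
  "generator S = {(u, v). ((\<lambda>h. (S h u - u) /\<^sub>R h) \<longlongrightarrow> v) (at 0)}"

definition schroedinger_group :: "(real \<Rightarrow> 'n::finite l2 \<Rightarrow>\<^sub>L 'n l2) \<Rightarrow> bool" where
  "schroedinger_group S \<longleftrightarrow> unitary_group S \<and> generator S = minus_i_laplacian"


section \<open>Trace-class operators\<close>

text \<open>All notions refer to the real inner product \<open>Re (\<integral> u cnj(v) dx)\<close> on \<open>'n l2\<close>.\<close>

definition nonneg_selfadjoint :: "('n::finite l2 \<Rightarrow>\<^sub>L 'n l2) \<Rightarrow> bool" where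
  "nonneg_selfadjoint Q \<longleftrightarrow>
     (\<forall>u v. inner (Q u) v = inner u (Q v)) \<and> (\<forall>u. 0 \<le> inner (Q u) u)"

text \<open>\<open>op_sqrt\<close> is meaningful for nonnegative self-adjoint operators, where the root exists and is unique.\<close>

definition op_sqrt :: "('n::finite l2 \<Rightarrow>\<^sub>L 'n l2) \<Rightarrow> 'n l2 \<Rightarrow>\<^sub>L 'n l2" where
  "op_sqrt Q = (THE R. nonneg_selfadjoint R \<and> R o\<^sub>L R = Q)"

definition orthonormal_basis :: "(nat \<Rightarrow> 'n::finite l2) \<Rightarrow> bool" where
  "orthonormal_basis e \<longleftrightarrow>
     (\<forall>i j. inner (e i) (e j) = (if i = j then 1 else 0)) \<and> closure (span (range e)) = UNIV"

text \<open>The squared Hilbert--Schmidt norm, which does not depend on the choice of the basis.\<close>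

definition hs_norm_sq :: "('n::finite l2 \<Rightarrow>\<^sub>L 'n l2) \<Rightarrow> ennreal" where
  "hs_norm_sq T =
     (let e = (SOME e :: nat \<Rightarrow> 'n l2. orthonormal_basis e) in \<Sum>j. ennreal ((norm (T (e j)))\<^sup>2))"

definition trace_class :: "('n::finite l2 \<Rightarrow>\<^sub>L 'n l2) \<Rightarrow> bool" where
  "trace_class Q \<longleftrightarrow> hs_norm_sq (op_sqrt Q) < \<infinity>"

definition op_trace :: "('n::finite l2 \<Rightarrow>\<^sub>L 'n l2) \<Rightarrow> real" where
  "op_trace Q = enn2real (hs_norm_sq (op_sqrt Q))"


section \<open>Wiener processes\<close>

text \<open>The time index is \<open>real\<close>, but only times \<open>t \<ge> 0\<close> are constrained.\<close>

definition normal_filtration :: "'w measure \<Rightarrow> (real \<Rightarrow> 'w measure) \<Rightarrow> bool" where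
  "normal_filtration M F \<longleftrightarrow>
     (\<forall>t\<ge>0. subalgebra M (F t)) \<and>
     (\<forall>s\<ge>0. \<forall>t\<ge>s. sets (F s) \<subseteq> sets (F t)) \<and>
     null_sets M \<subseteq> sets (F 0) \<and>
     (\<forall>t\<ge>0. sets (F t) = (\<Inter>s\<in>{t<..}. sets (F s)))"

definition brownian_motion :: "'w measure \<Rightarrow> (real \<Rightarrow> 'w \<Rightarrow> real) \<Rightarrow> bool" where
  "brownian_motion M \<beta> \<longleftrightarrow>
     (\<forall>t\<ge>0. \<beta> t \<in> borel_measurable M) \<and>
     (AE \<omega> in M. \<beta> 0 \<omega> = 0) \<and>
     (AE \<omega> in M. continuous_on {0..} (\<lambda>t. \<beta> t \<omega>)) \<and>
     (\<forall>s\<ge>0. \<forall>t>s.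
        distributed M lborel (\<lambda>\<omega>. \<beta> t \<omega> - \<beta> s \<omega>) (normal_density 0 (sqrt (t - s))) \<and>
        prob_space.indep_set M
          (sets (vimage_algebra (space M) (\<lambda>\<omega>. \<lambda>r\<in>{0..s}. \<beta> r \<omega>) (PiM {0..s} (\<lambda>_. borel))))
          (sets (vimage_algebra (space M) (\<lambda>\<omega>. \<beta> t \<omega> - \<beta> s \<omega>) borel)))"

text \<open>The expansion \<open>W(t) = \<Sum>j. \<beta>\<^sub>j(t) Q\<^sup>1\<^sup>/\<^sup>2 e\<^sub>j\<close> converges in \<open>L\<^sup>2(\<Omega>; L\<^sup>2)\<close>. It determines the law of \<open>W\<close>; the relation
  to the filtration is expressed through \<open>W\<close> itself (adapted, future increments independent of \<open>F s\<close>).\<close>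

definition q_wiener_process ::
  "'w measure \<Rightarrow> (real \<Rightarrow> 'w measure) \<Rightarrow> ('n::finite l2 \<Rightarrow>\<^sub>L 'n l2) \<Rightarrow> (real \<Rightarrow> 'w \<Rightarrow> 'n l2) \<Rightarrow> bool" where
  "q_wiener_process M F Q W \<longleftrightarrow>
     (\<forall>t\<ge>0. W t \<in> borel_measurable (F t)) \<and>
     (AE \<omega> in M. continuous_on {0..} (\<lambda>t. W t \<omega>)) \<and>
     (\<forall>s\<ge>0. \<forall>t\<ge>s. prob_space.indep_set M (sets (F s))
        (sets (vimage_algebra (space M) (\<lambda>\<omega>. W t \<omega> - W s \<omega>) borel))) \<and>
     (\<exists>e \<beta>. orthonormal_basis e \<and>
        (\<forall>j. brownian_motion M (\<beta> j)) \<and>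
        prob_space.indep_vars M (\<lambda>_::nat. PiM {0..} (\<lambda>_. borel)) (\<lambda>j \<omega>. \<lambda>t\<in>{0..}. \<beta> j t \<omega>) UNIV \<and>
        (\<forall>t\<ge>0. (\<lambda>n. \<integral>\<^sup>+ \<omega>. ennreal ((norm (W t \<omega> - (\<Sum>j<n. \<beta> j t \<omega> *\<^sub>R op_sqrt Q (e j))))\<^sup>2) \<partial>M)
           \<longlonglongrightarrow> 0))"


section \<open>The stochastic integral and mild solutions\<close>

text \<open>An elementary process on \<open>[0,t]\<close> has the form \<open>\<Sum>m<N. 1\<^bsub>(\<tau> m, \<tau> (m+1)]\<^esub> \<Phi> m\<close>, where \<open>\<Phi> m\<close> is an
  \<open>F (\<tau> m)\<close>-measurable random operator with finitely many values.\<close>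

definition elementary_process ::
  "(real \<Rightarrow> 'w measure) \<Rightarrow> real \<Rightarrow> nat \<Rightarrow> (nat \<Rightarrow> real) \<Rightarrow> (nat \<Rightarrow> 'w \<Rightarrow> 'n::finite l2 \<Rightarrow>\<^sub>L 'n l2) \<Rightarrow> bool" where
  "elementary_process F t N \<tau> \<Phi> \<longleftrightarrow>
     \<tau> 0 = 0 \<and> \<tau> N = t \<and> (\<forall>m<N. \<tau> m \<le> \<tau> (Suc m) \<and> simple_function (F (\<tau> m)) (\<Phi> m))"

definition elementary_value ::
  "nat \<Rightarrow> (nat \<Rightarrow> real) \<Rightarrow> (nat \<Rightarrow> 'w \<Rightarrow> 'n::finite l2 \<Rightarrow>\<^sub>L 'n l2) \<Rightarrow> real \<Rightarrow> 'w \<Rightarrow> 'n l2 \<Rightarrow>\<^sub>L 'n l2" where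
  "elementary_value N \<tau> \<Phi> r \<omega> = (\<Sum>m<N. indicator {\<tau> m<..\<tau> (Suc m)} r *\<^sub>R \<Phi> m \<omega>)"

definition elementary_integral ::
  "(real \<Rightarrow> 'w \<Rightarrow> 'n::finite l2) \<Rightarrow> nat \<Rightarrow> (nat \<Rightarrow> real) \<Rightarrow> (nat \<Rightarrow> 'w \<Rightarrow> 'n l2 \<Rightarrow>\<^sub>L 'n l2) \<Rightarrow> 'w \<Rightarrow> 'n l2" where
  "elementary_integral W N \<tau> \<Phi> \<omega> = (\<Sum>m<N. \<Phi> m \<omega> (W (\<tau> (Suc m)) \<omega> - W (\<tau> m) \<omega>))"

text \<open>\<open>I\<close> is (a version of) the Ito integral of \<open>\<Psi>\<close> with respect to the \<open>Q\<close>-Wiener process \<open>W\<close> over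
  \<open>[0,t]\<close>: the limit of the integrals of elementary processes that approximate \<open>\<Psi>\<close> in the norm
  \<open>(\<bbbE> \<integral>\<^sub>0\<^sup>t \<parallel>\<Psi>(r) Q\<^sup>1\<^sup>/\<^sup>2\<parallel>\<^sup>2 dr)\<^sup>1\<^sup>/\<^sup>2\<close>, with the Hilbert--Schmidt norm inside.\<close>

definition has_ito_integral ::
  "'w measure \<Rightarrow> (real \<Rightarrow> 'w measure) \<Rightarrow> ('n::finite l2 \<Rightarrow>\<^sub>L 'n l2) \<Rightarrow> (real \<Rightarrow> 'w \<Rightarrow> 'n l2) \<Rightarrow>
   (real \<Rightarrow> 'w \<Rightarrow> 'n l2 \<Rightarrow>\<^sub>L 'n l2) \<Rightarrow> real \<Rightarrow> ('w \<Rightarrow> 'n l2) \<Rightarrow> bool" where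
  "has_ito_integral M F Q W \<Psi> t I \<longleftrightarrow>
     I \<in> borel_measurable M \<and>
     (\<exists>N \<tau> \<Phi>.
        (\<forall>n. elementary_process F t (N n) (\<tau> n) (\<Phi> n)) \<and>
        (\<lambda>n::nat. \<integral>\<^sup>+ \<omega>. (\<integral>\<^sup>+ r\<in>{0..t}.
             hs_norm_sq ((\<Psi> r \<omega> - elementary_value (N n) (\<tau> n) (\<Phi> n) r \<omega>) o\<^sub>L op_sqrt Q) \<partial>lborel) \<partial>M)
          \<longlonglongrightarrow> 0 \<and>
        (\<lambda>n. \<integral>\<^sup>+ \<omega>. ennreal ((norm (elementary_integral W (N n) (\<tau> n) (\<Phi> n) \<omega> - I \<omega>))\<^sup>2) \<partial>M)
          \<longlonglongrightarrow> 0)"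

text \<open>The mild solution of \<open>\<i> du - \<Delta>u dt = dW\<close>, \<open>u(0) = u\<^sub>0\<close>.\<close>

definition mild_solution ::
  "'w measure \<Rightarrow> (real \<Rightarrow> 'w measure) \<Rightarrow> ('n::finite l2 \<Rightarrow>\<^sub>L 'n l2) \<Rightarrow> (real \<Rightarrow> 'w \<Rightarrow> 'n l2) \<Rightarrow>
   (real \<Rightarrow> 'n l2 \<Rightarrow>\<^sub>L 'n l2) \<Rightarrow> ('w \<Rightarrow> 'n l2) \<Rightarrow> (real \<Rightarrow> 'w \<Rightarrow> 'n l2) \<Rightarrow> bool" where
  "mild_solution M F Q W S u\<^sub>0 u \<longleftrightarrow>
     (\<forall>t\<ge>0. u t \<in> borel_measurable (F t) \<and>
        (\<exists>I. has_ito_integral M F Q W (\<lambda>r \<omega>. S (t - r)) t I \<and>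
             (AE \<omega> in M. u t \<omega> = S t (u\<^sub>0 \<omega>) - \<i> *\<^sub>C I \<omega>)))"

end

theory Submission
  imports Defs
begin

text \<open>
  The mild solution at time \<open>t\<close> is the sum of \<open>S(t) u\<^sub>0\<close> and \<open>-\<i> \<integral>\<^sub>0\<^sup>t S(t-r) dW(r)\<close>. The group is isometric, so
  the first part has the second moment of \<open>u\<^sub>0\<close>, and by the Ito isometry the second part has the second moment
  \<open>\<integral>\<^sub>0\<^sup>t \<parallel>S(t-r) Q\<^sup>1\<^sup>/\<^sup>2\<parallel>\<^sub>H\<^sub>S\<^sup>2 dr = t \<parallel>Q\<^sup>1\<^sup>/\<^sup>2\<parallel>\<^sub>H\<^sub>S\<^sup>2 = t Tr(Q)\<close>. The first part is known at time \<open>0\<close>, hence orthogonal in mean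
  to the stochastic integral, and Pythagoras' identity adds the two numbers.

  Both facts about the stochastic integral hold for elementary integrands and pass to the limit. For an elementary
  integrand they reduce (\<open>ito_step\<close>, \<open>elementary_integral_moments\<close>) to a single increment of \<open>W\<close>, which is
  independent of the past, has mean zero, and satisfies \<open>\<bbbE> \<parallel>A (W(t) - W(s))\<parallel>\<^sup>2 = (t - s) \<parallel>A Q\<^sup>1\<^sup>/\<^sup>2\<parallel>\<^sub>H\<^sub>S\<^sup>2\<close> by the
  expansion of \<open>W\<close> in Brownian motions (\<open>random_series\<close>, \<open>dW_moments\<close>).
  In the limit, second moments converge by \<open>tendsto_quasi_triangle\<close> and orthogonality is read off from
  Pythagoras' identity (\<open>L2_limit_orthogonal\<close>).

  Two points need care. The expansion of \<open>W\<close> uses some orthonormal basis, whereas the trace is computed in a fixed one: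
  the Hilbert--Schmidt norm of an arbitrary bounded operator is shown to be independent of the basis
  (\<open>norm_sq_series_basis_independent\<close>). Moreover, sums and
  inner products of \<open>L\<^sup>2\<close>-valued random variables must be measurable; this follows from the
  expansion in a countable basis (\<open>measurable_if_coordinates_measurable\<close>).
\<close>

section \<open>Orthonormal sequences with dense span\<close>

text \<open>The countable basis makes the space separable: measurability and second moments of vector-valued
  functions reduce to those of their real coordinates.\<close>
locale hilbert_basis =
  fixes e :: "nat \<Rightarrow> 'a::real_inner"
  assumes orthonormal: "inner (e i) (e j) = (if i = j then 1 else 0)"
    and dense_span: "closure (span (range e)) = UNIV"
begin

definition proj :: "nat \<Rightarrow> 'a \<Rightarrow> 'a" where
  "proj n x = (\<Sum>j<n. inner x (e j) *\<^sub>R e j)"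

lemma inner_combination: "inner (\<Sum>j<n. c j *\<^sub>R e j) (e k) = (if k < n then c k else 0)"
  by (simp add: inner_sum_left orthonormal if_distrib[of "(*) _"] cong: if_cong)

lemma inner_combinations: "inner (\<Sum>j<n. c j *\<^sub>R e j) (\<Sum>j<n. d j *\<^sub>R e j) = (\<Sum>j<n. c j * d j)"
proof -
  have "inner (\<Sum>j<n. c j *\<^sub>R e j) (\<Sum>j<n. d j *\<^sub>R e j) =
     (\<Sum>k<n. d k * inner (\<Sum>j<n. c j *\<^sub>R e j) (e k))"
    by (simp only: inner_sum_right[of _ _ "{..<n}"] inner_scaleR_right)
  then show ?thesis by (simp add: inner_combination mult.commute)
qed

lemma inner_proj_proj: "inner (proj n x) (proj n y) = (\<Sum>j<n. inner x (e j) * inner y (e j))"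
  unfolding proj_def by (rule inner_combinations)

lemma inner_proj: "inner (proj n x) y = (\<Sum>j<n. inner x (e j) * inner y (e j))"
  by (simp add: proj_def inner_sum_left inner_commute[of y])

lemma norm_proj_le: "norm (proj n x) \<le> norm x"
proof -
  have "(norm (proj n x))\<^sup>2 = inner (proj n x) x"
    by (simp only: power2_norm_eq_inner inner_proj_proj) (simp only: inner_proj)
  also have "\<dots> \<le> norm (proj n x) * norm x" by (rule norm_cauchy_schwarz)
  finally show ?thesis
    by (cases "proj n x = 0") (auto simp: power2_eq_square)
qed

lemma proj_add: "proj n (x + y) = proj n x + proj n y"
  by (simp add: proj_def inner_add_left scaleR_add_left sum.distrib)

lemma proj_diff: "proj n (x - y) = proj n x - proj n y"
  by (simp add: proj_def inner_diff_left scaleR_diff_left sum_subtractf)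

lemma proj_span:
  assumes "y \<in> span (range e)"
  shows "\<exists>m. \<forall>n\<ge>m. proj n y = y"
  using assms
proof (induction rule: span_induct_alt)
  case base
  show ?case by (simp add: proj_def)
next
  case (step c x y)
  then obtain k m where k: "x = e k" and m: "\<And>n. n \<ge> m \<Longrightarrow> proj n y = y" by auto
  have "proj n (c *\<^sub>R x + y) = c *\<^sub>R x + y" if "n \<ge> max m (Suc k)" for n
  proof -
    have "proj n (c *\<^sub>R e k) = (\<Sum>j<n. if k = j then c *\<^sub>R e j else 0)"
      unfolding proj_def by (intro sum.cong) (auto simp: orthonormal)
    then show ?thesis using that m[of n] by (simp add: proj_add k)
  qed
  then show ?case by blast
qed

text \<open>A vector in the dense span is fixed by \<open>proj n\<close> for large \<open>n\<close>, and the \<open>proj n\<close> are uniformly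
  bounded, so convergence passes from the span to its closure.\<close>
lemma proj_tendsto: "(\<lambda>n. proj n x) \<longlonglongrightarrow> x"
proof (rule LIMSEQ_I)
  fix r :: real assume r: "r > 0"
  have "x \<in> closure (span (range e))" by (simp add: dense_span)
  then obtain y where y: "y \<in> span (range e)" "dist y x < r / 2"
    using r half_gt_zero unfolding closure_approachable by blast
  obtain m where m: "\<And>n. n \<ge> m \<Longrightarrow> proj n y = y" using proj_span[OF y(1)] by auto
  have "norm (proj n x - x) < r" if "n \<ge> m" for n
  proof -
    have "proj n x - x = proj n (x - y) - (x - y)" using m[OF that] by (simp add: proj_diff)
    then have "norm (proj n x - x) \<le> norm (proj n (x - y)) + norm (x - y)"
      by (simp only: norm_triangle_ineq4)
    also have "\<dots> \<le> 2 * norm (x - y)" using norm_proj_le[of n "x - y"] by simp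
    finally show ?thesis using y(2) by (simp add: dist_norm norm_minus_commute)
  qed
  then show "\<exists>m. \<forall>n\<ge>m. norm (proj n x - x) < r" by blast
qed

lemma parseval: "(\<lambda>j. inner x (e j) * inner y (e j)) sums inner x y"
proof -
  have "(\<lambda>n. inner (proj n x) y) \<longlonglongrightarrow> inner x y"
    by (intro tendsto_intros proj_tendsto)
  then show ?thesis by (simp add: sums_def inner_proj)
qed

lemma parseval_norm: "(\<lambda>j. (inner x (e j))\<^sup>2) sums (norm x)\<^sup>2"
  using parseval[of x x] by (simp add: power2_eq_square flip: power2_norm_eq_inner)

lemma parseval_norm_ennreal: "(\<Sum>j. ennreal ((inner x (e j))\<^sup>2)) = ennreal ((norm x)\<^sup>2)"
  using parseval_norm[of x] by (intro suminf_ennreal_eq) auto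

lemma bounded_linear_expansion:
  assumes "bounded_linear \<phi>"
  shows "(\<lambda>n. \<Sum>j<n. inner x (e j) *\<^sub>R \<phi> (e j)) \<longlonglongrightarrow> \<phi> x"
proof -
  have "(\<lambda>n. \<phi> (proj n x)) \<longlonglongrightarrow> \<phi> x"
    by (rule bounded_linear.tendsto[OF assms proj_tendsto])
  then show ?thesis
    by (simp add: proj_def bounded_linear.linear[OF assms] linear_sum linear_scale)
qed

text \<open>Both sides are the square of the operator norm of \<open>\<phi>\<close>. The vector \<open>v\<close> with coordinates
  \<open>\<phi> (f j)\<close>, \<open>j < n\<close>, satisfies \<open>\<phi> v = (norm v)\<^sup>2\<close>; expanding \<open>v\<close> in the other basis and applying
  Cauchy--Schwarz there bounds \<open>\<phi> v\<close> by \<open>norm v\<close> times the square root of the right-hand side.\<close>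
lemma functional_norm_sq_le:
  fixes \<phi> :: "'a \<Rightarrow> real" and f :: "nat \<Rightarrow> 'a"
  assumes f: "hilbert_basis f" and \<phi>: "bounded_linear \<phi>"
  shows "(\<Sum>j. ennreal ((\<phi> (f j))\<^sup>2)) \<le> (\<Sum>j. ennreal ((\<phi> (e j))\<^sup>2))"
proof (rule suminf_le_const)
  interpret f: hilbert_basis f by (rule f)
  interpret \<phi>: bounded_linear \<phi> by (rule \<phi>)
  fix n
  define v where "v = (\<Sum>j<n. \<phi> (f j) *\<^sub>R f j)"
  have v2: "(norm v)\<^sup>2 = (\<Sum>j<n. (\<phi> (f j))\<^sup>2)"
    unfolding power2_norm_eq_inner v_def f.inner_combinations by (simp add: power2_eq_square)
  have v: "\<phi> v = (norm v)\<^sup>2" 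
    unfolding v2 by (simp add: v_def \<phi>.sum \<phi>.scaleR power2_eq_square)
  have "ennreal ((norm v)\<^sup>2) \<le> (\<Sum>j. ennreal ((\<phi> (e j))\<^sup>2))"
  proof (cases "(\<Sum>j. ennreal ((\<phi> (e j))\<^sup>2)) = top")
    case False
    define K where "K = enn2real (\<Sum>j. ennreal ((\<phi> (e j))\<^sup>2))"
    have K: "ennreal K = (\<Sum>j. ennreal ((\<phi> (e j))\<^sup>2))" "K \<ge> 0"
      using False by (simp_all add: K_def less_top)
    have "\<phi> v \<le> norm v * sqrt K"
    proof (rule LIMSEQ_le_const2[OF bounded_linear_expansion[OF \<phi>]], intro exI allI impI)
      fix N :: nat
      have "ennreal (\<Sum>j<N. (\<phi> (e j))\<^sup>2) = (\<Sum>j<N. ennreal ((\<phi> (e j))\<^sup>2))" by simp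
      also have "\<dots> \<le> ennreal K" unfolding K(1) by (rule sum_le_suminf) auto
      finally have le: "(\<Sum>j<N. (\<phi> (e j))\<^sup>2) \<le> K" using K(2) by simp
      have "(\<Sum>j<N. inner v (e j) *\<^sub>R \<phi> (e j)) = inner (proj N v) (\<Sum>j<N. \<phi> (e j) *\<^sub>R e j)"
        by (simp add: proj_def inner_combinations)
      also have "\<dots> \<le> norm (proj N v) * norm (\<Sum>j<N. \<phi> (e j) *\<^sub>R e j)"
        by (rule norm_cauchy_schwarz)
      also have "\<dots> \<le> norm v * sqrt K"
      proof (rule mult_mono[OF norm_proj_le])
        show "norm (\<Sum>j<N. \<phi> (e j) *\<^sub>R e j) \<le> sqrt K"
          using le by (simp add: norm_eq_sqrt_inner inner_combinations power2_eq_square)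
      qed auto
      finally show "(\<Sum>j<N. inner v (e j) *\<^sub>R \<phi> (e j)) \<le> norm v * sqrt K" .
    qed
    then have "norm v \<le> sqrt K"
      using K(2) by (cases "v = 0") (auto simp: v power2_eq_square)
    then have "(norm v)\<^sup>2 \<le> (sqrt K)\<^sup>2" by (intro power_mono) auto
    then show ?thesis using K by (simp add: ennreal_leI flip: K(1))
  qed simp
  then show "(\<Sum>j<n. ennreal ((\<phi> (f j))\<^sup>2)) \<le> (\<Sum>j. ennreal ((\<phi> (e j))\<^sup>2))"
    by (simp add: v2)
qed auto

text \<open>By Parseval and an exchange of sums, the square of the Hilbert--Schmidt norm is the sum over \<open>k\<close> of the
  squared norms of the functionals \<open>\<lambda>x. inner (T x) (e k)\<close>. Arguing with functionals instead of the adjoint of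
  \<open>T\<close> gives the statement for every bounded operator.\<close>
lemma norm_sq_series_basis_independent:
  fixes T :: "'a \<Rightarrow> 'a" and f :: "nat \<Rightarrow> 'a"
  assumes f: "hilbert_basis f" and T: "bounded_linear T"
  shows "(\<Sum>j. ennreal ((norm (T (f j)))\<^sup>2)) = (\<Sum>j. ennreal ((norm (T (e j)))\<^sup>2))"
proof -
  have swap: "(\<Sum>j. ennreal ((norm (T (g j)))\<^sup>2)) = (\<Sum>k. \<Sum>j. ennreal ((inner (T (g j)) (e k))\<^sup>2))"
    for g :: "nat \<Rightarrow> 'a"
  proof -
    have "(\<Sum>j. ennreal ((norm (T (g j)))\<^sup>2)) =
        (\<integral>\<^sup>+j. (\<Sum>k. ennreal ((inner (T (g j)) (e k))\<^sup>2)) \<partial>count_space UNIV)"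
      by (simp add: nn_integral_count_space_nat parseval_norm_ennreal)
    then show ?thesis by (subst (asm) nn_integral_suminf) (auto simp: nn_integral_count_space_nat)
  qed
  have "(\<Sum>j. ennreal ((inner (T (f j)) (e k))\<^sup>2)) = (\<Sum>j. ennreal ((inner (T (e j)) (e k))\<^sup>2))" for k
  proof (rule antisym)
    have bl: "bounded_linear (\<lambda>x. inner (T x) (e k))"
      by (rule bounded_linear_compose[OF bounded_linear_inner_left T])
    have e: "hilbert_basis e" by (rule hilbert_basis_axioms)
    show "(\<Sum>j. ennreal ((inner (T (f j)) (e k))\<^sup>2)) \<le> (\<Sum>j. ennreal ((inner (T (e j)) (e k))\<^sup>2))"
      by (rule functional_norm_sq_le[OF f bl])
    show "(\<Sum>j. ennreal ((inner (T (e j)) (e k))\<^sup>2)) \<le> (\<Sum>j. ennreal ((inner (T (f j)) (e k))\<^sup>2))"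
      by (rule hilbert_basis.functional_norm_sq_le[OF f e bl])
  qed
  then show ?thesis by (simp add: swap[of e] swap[of f])
qed

end

section \<open>Measurable functions into a separable inner product space\<close>

context hilbert_basis
begin

text \<open>The projections \<open>proj n \<circ> f\<close> depend continuously on the coordinates, and \<open>f\<close> is their pointwise limit.
  Closure of the Borel functions under sums and multiples then follows coordinatewise.\<close>
lemma measurable_if_coordinates_measurable:
  assumes "\<And>j. (\<lambda>\<omega>. inner (f \<omega>) (e j)) \<in> borel_measurable N"
  shows "f \<in> borel_measurable N"
proof (rule borel_measurable_LIMSEQ_metric)
  fix n
  have "(\<lambda>\<omega> j. inner (f \<omega>) (e j)) \<in> borel_measurable N"
    using assms by (rule measurable_coordinatewise_then_product)
  moreover have "continuous_on UNIV (\<lambda>c. \<Sum>j<n. c j *\<^sub>R e j)"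
    by (intro continuous_intros continuous_on_product_coordinates)
  ultimately show "(\<lambda>\<omega>. proj n (f \<omega>)) \<in> borel_measurable N"
    unfolding proj_def by (rule measurable_compose[OF _ borel_measurable_continuous_onI])
qed (rule proj_tendsto)

lemma continuous_measurable:
  assumes "f \<in> borel_measurable N" "continuous_on UNIV g"
  shows "(\<lambda>\<omega>. g (f \<omega>)) \<in> borel_measurable N"
  by (rule measurable_compose[OF assms(1) borel_measurable_continuous_onI[OF assms(2)]])

lemma inner_const_measurable:
  "f \<in> borel_measurable N \<Longrightarrow> (\<lambda>\<omega>. inner (f \<omega>) (v::'a)) \<in> borel_measurable N"
  by (erule continuous_measurable) (intro continuous_intros)

lemma inner_measurable:
  assumes "f \<in> borel_measurable N" "g \<in> borel_measurable N"
  shows "(\<lambda>\<omega>. inner (f \<omega>) (g \<omega> :: 'a)) \<in> borel_measurable N"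
proof (rule borel_measurable_LIMSEQ_metric)
  show "(\<lambda>\<omega>. \<Sum>j<n. inner (f \<omega>) (e j) * inner (g \<omega>) (e j)) \<in> borel_measurable N" for n
    by (intro borel_measurable_sum borel_measurable_times inner_const_measurable assms)
qed (use parseval in \<open>simp add: sums_def\<close>)

lemma add_measurable:
  assumes "f \<in> borel_measurable N" "g \<in> borel_measurable N"
  shows "(\<lambda>\<omega>. f \<omega> + g \<omega> :: 'a) \<in> borel_measurable N"
  by (rule measurable_if_coordinates_measurable)
    (simp add: inner_add_left borel_measurable_add inner_const_measurable assms)

lemma diff_measurable:
  assumes "f \<in> borel_measurable N" "g \<in> borel_measurable N"
  shows "(\<lambda>\<omega>. f \<omega> - g \<omega> :: 'a) \<in> borel_measurable N"
  by (rule measurable_if_coordinates_measurable)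
    (simp add: inner_diff_left borel_measurable_diff inner_const_measurable assms)

lemma sum_measurable:
  assumes "\<And>i. i \<in> I \<Longrightarrow> f i \<in> borel_measurable N"
  shows "(\<lambda>\<omega>. \<Sum>i\<in>I. f i \<omega> :: 'a) \<in> borel_measurable N"
  by (rule measurable_if_coordinates_measurable)
    (simp add: inner_sum_left borel_measurable_sum inner_const_measurable assms)

lemma scaleR_measurable:
  assumes "c \<in> borel_measurable N" "f \<in> borel_measurable N"
  shows "(\<lambda>\<omega>. c \<omega> *\<^sub>R f \<omega> :: 'a) \<in> borel_measurable N"
  by (rule measurable_if_coordinates_measurable)
    (simp add: borel_measurable_times inner_const_measurable assms)

lemma norm_measurable:
  assumes "f \<in> borel_measurable N"
  shows "(\<lambda>\<omega>. norm (f \<omega> :: 'a)) \<in> borel_measurable N"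
  using assms by (rule continuous_measurable) (intro continuous_intros)

end

section \<open>Square integrable vector-valued functions\<close>

text \<open>Think of \<open>a n\<close>, \<open>b\<close> and \<open>d n\<close> as the squared \<open>L\<^sup>2\<close>-norms of \<open>f n\<close>, \<open>f\<close> and \<open>f n - f\<close>. The hypotheses
  are the squared triangle inequality with weights, which can be checked pointwise and then integrated
  or summed, also where the norms may be infinite.\<close>
lemma tendsto_quasi_triangle:
  fixes a d :: "nat \<Rightarrow> ennreal" and b :: ennreal
  assumes upper: "\<And>n \<delta>. 0 < \<delta> \<Longrightarrow> a n \<le> ennreal (1 + \<delta>) * b + ennreal (1 + 1 / \<delta>) * d n"
    and lower: "\<And>n \<delta>. 0 < \<delta> \<Longrightarrow> b \<le> ennreal (1 + \<delta>) * a n + ennreal (1 + 1 / \<delta>) * d n"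
    and d: "d \<longlonglongrightarrow> 0"
  shows "a \<longlonglongrightarrow> b"
proof -
  \<comment> \<open>take \<open>\<delta>\<close> so small that \<open>(1 + \<delta>) y\<close> is still below \<open>z\<close>, then \<open>n\<close> large\<close>
  have gap: "\<exists>\<delta>>0. eventually (\<lambda>n. ennreal (1 + \<delta>) * y + ennreal (1 + 1 / \<delta>) * d n < z) sequentially"
    if "y < z" for y z :: ennreal
  proof -
    have "(\<lambda>k. ennreal (1 + inverse (real (Suc k)))) \<longlonglongrightarrow> ennreal (1 + 0)"
      by (intro tendsto_intros LIMSEQ_inverse_real_of_nat)
    then have "(\<lambda>k. y * ennreal (1 + inverse (real (Suc k)))) \<longlonglongrightarrow> y * ennreal (1 + 0)"
      using that by (intro ennreal_tendsto_cmult) (auto simp: less_top[symmetric])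
    then have "(\<lambda>k. ennreal (1 + inverse (real (Suc k))) * y) \<longlonglongrightarrow> y"
      by (simp add: mult.commute)
    then have "eventually (\<lambda>k. ennreal (1 + inverse (real (Suc k))) * y < z) sequentially"
      using that by (intro order_tendstoD(2)) auto
    then obtain k where k: "ennreal (1 + inverse (real (Suc k))) * y < z"
      by (auto simp: eventually_sequentially)
    define \<delta> where "\<delta> = inverse (real (Suc k))"
    have "(\<lambda>n. ennreal (1 + \<delta>) * y + ennreal (1 + 1 / \<delta>) * d n) \<longlonglongrightarrow>
        ennreal (1 + \<delta>) * y + ennreal (1 + 1 / \<delta>) * 0"
      by (intro tendsto_add tendsto_const ennreal_tendsto_cmult d) auto
    then have "eventually (\<lambda>n. ennreal (1 + \<delta>) * y + ennreal (1 + 1 / \<delta>) * d n < z) sequentially"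
      using k by (intro order_tendstoD(2)) (auto simp: \<delta>_def)
    moreover have "\<delta> > 0" by (simp add: \<delta>_def)
    ultimately show ?thesis by blast
  qed
  show ?thesis
  proof (rule order_tendstoI)
    fix z assume "b < z"
    then obtain \<delta> where "\<delta> > 0"
      "eventually (\<lambda>n. ennreal (1 + \<delta>) * b + ennreal (1 + 1 / \<delta>) * d n < z) sequentially"
      using gap by blast
    then show "eventually (\<lambda>n. a n < z) sequentially"
      using upper by (auto elim!: eventually_mono intro: le_less_trans)
  next
    fix y assume "y < b"
    then obtain \<delta> where \<delta>: "\<delta> > 0"
      "eventually (\<lambda>n. ennreal (1 + \<delta>) * y + ennreal (1 + 1 / \<delta>) * d n < b) sequentially"
      using gap by blast
    from \<delta>(2) show "eventually (\<lambda>n. y < a n) sequentially"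
    proof (rule eventually_mono)
      fix n assume n: "ennreal (1 + \<delta>) * y + ennreal (1 + 1 / \<delta>) * d n < b"
      show "y < a n"
      proof (rule ccontr)
        assume "\<not> y < a n"
        then have "ennreal (1 + \<delta>) * a n + ennreal (1 + 1 / \<delta>) * d n \<le>
            ennreal (1 + \<delta>) * y + ennreal (1 + 1 / \<delta>) * d n"
          by (intro add_mono mult_left_mono) auto
        then show False using lower[OF \<delta>(1), of n] n by (meson leD order_trans)
      qed
    qed
  qed
qed

text \<open>Young's inequality \<open>2 p q \<le> \<delta> p\<^sup>2 + q\<^sup>2 / \<delta>\<close> for the mixed term.\<close>
lemma norm_sq_quasi_triangle:
  fixes x y :: "'a::real_inner"
  assumes "0 < \<delta>"
  shows "ennreal ((norm x)\<^sup>2) \<le>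
    ennreal (1 + \<delta>) * ennreal ((norm y)\<^sup>2) + ennreal (1 + 1 / \<delta>) * ennreal ((norm (x - y))\<^sup>2)"
proof -
  have "norm x \<le> norm y + norm (x - y)" by (metis norm_triangle_sub)
  then have "(norm x)\<^sup>2 \<le> (norm y + norm (x - y))\<^sup>2" by (intro power_mono) auto
  moreover have "0 \<le> (sqrt \<delta> * norm y - norm (x - y) / sqrt \<delta>)\<^sup>2" by simp
  then have "2 * (norm y * norm (x - y)) \<le> \<delta> * (norm y)\<^sup>2 + (norm (x - y))\<^sup>2 / \<delta>"
    using assms by (simp add: power2_diff power_mult_distrib power_divide)
  ultimately have "(norm x)\<^sup>2 \<le> (1 + \<delta>) * (norm y)\<^sup>2 + (1 + 1 / \<delta>) * (norm (x - y))\<^sup>2"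
    by (simp add: power2_sum algebra_simps)
  then show ?thesis
    using assms by (simp flip: ennreal_mult ennreal_plus)
qed

lemma norm_sq_add_le: "(norm (x + y))\<^sup>2 \<le> 2 * (norm x)\<^sup>2 + 2 * (norm (y::'a::real_inner))\<^sup>2"
  using zero_le_power2[of "norm (x - y)"]
  unfolding power2_norm_eq_inner by (simp add: inner_simps inner_commute)

lemma abs_inner_le_norm_sq: "\<bar>inner x y\<bar> \<le> (norm x)\<^sup>2 + (norm (y::'a::real_inner))\<^sup>2"
proof -
  have "\<bar>inner x y\<bar> \<le> norm x * norm y" by (rule Cauchy_Schwarz_ineq2)
  moreover have "0 \<le> (norm x - norm y)\<^sup>2" "0 \<le> norm x * norm y" by simp_all
  then have "norm x * norm y \<le> (norm x)\<^sup>2 + (norm y)\<^sup>2" unfolding power2_diff by linarith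
  ultimately show ?thesis by linarith
qed

definition L2 :: "'w measure \<Rightarrow> ('w \<Rightarrow> 'a::real_inner) \<Rightarrow> bool" where
  "L2 N X \<longleftrightarrow> X \<in> borel_measurable N \<and> integrable N (\<lambda>\<omega>. (norm (X \<omega>))\<^sup>2)"

lemma L2_measurable: "L2 N X \<Longrightarrow> X \<in> borel_measurable N"
  by (simp add: L2_def)

lemma L2_integrable: "L2 N X \<Longrightarrow> integrable N (\<lambda>\<omega>. (norm (X \<omega>))\<^sup>2)"
  by (simp add: L2_def)

lemma (in prob_space) L2_const: "L2 M (\<lambda>_. c)"
  by (simp add: L2_def)

context hilbert_basis
begin

lemma norm_sq_measurable:
  "X \<in> borel_measurable N \<Longrightarrow> (\<lambda>\<omega>. (norm (X \<omega> :: 'a))\<^sup>2) \<in> borel_measurable N"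
  by (intro borel_measurable_power norm_measurable)

lemma norm_sq_measurable_ennreal:
  "X \<in> borel_measurable N \<Longrightarrow> (\<lambda>\<omega>. ennreal ((norm (X \<omega> :: 'a))\<^sup>2)) \<in> borel_measurable N"
  by (intro measurable_compose[OF norm_sq_measurable measurable_ennreal])

lemma L2_iff_nn_integral:
  fixes X :: "'w \<Rightarrow> 'a"
  assumes "X \<in> borel_measurable N"
  shows "L2 N X \<longleftrightarrow> (\<integral>\<^sup>+\<omega>. ennreal ((norm (X \<omega>))\<^sup>2) \<partial>N) < \<infinity>"
  using assms norm_sq_measurable[OF assms] by (simp add: L2_def integrable_iff_bounded)

lemma L2_add:
  fixes X Y :: "'w \<Rightarrow> 'a"
  assumes "L2 N X" "L2 N Y"
  shows "L2 N (\<lambda>\<omega>. X \<omega> + Y \<omega>)"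
proof -
  have m: "(\<lambda>\<omega>. X \<omega> + Y \<omega>) \<in> borel_measurable N"
    using assms by (intro add_measurable L2_measurable)
  have "integrable N (\<lambda>\<omega>. 2 * (norm (X \<omega>))\<^sup>2 + 2 * (norm (Y \<omega>))\<^sup>2)"
    using assms by (simp add: L2_integrable)
  then have "integrable N (\<lambda>\<omega>. (norm (X \<omega> + Y \<omega>))\<^sup>2)"
    by (rule Bochner_Integration.integrable_bound) (auto intro!: AE_I2 norm_sq_measurable m norm_sq_add_le)
  with m show ?thesis by (simp add: L2_def)
qed

lemma L2_bounded_linear:
  fixes X :: "'w \<Rightarrow> 'a" and T :: "'a \<Rightarrow> 'a"
  assumes "L2 N X" "bounded_linear T"
  shows "L2 N (\<lambda>\<omega>. T (X \<omega>))"
proof -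
  have m: "(\<lambda>\<omega>. T (X \<omega>)) \<in> borel_measurable N"
    by (rule continuous_measurable[OF L2_measurable[OF assms(1)] linear_continuous_on[OF assms(2)]])
  obtain K where K: "\<And>x. norm (T x) \<le> norm x * K" using bounded_linear.bounded[OF assms(2)] by blast
  have le: "(norm (T x))\<^sup>2 \<le> K\<^sup>2 * (norm x)\<^sup>2" for x
    using power_mono[OF K[of x], of 2] by (simp add: power_mult_distrib mult.commute)
  have "integrable N (\<lambda>\<omega>. K\<^sup>2 * (norm (X \<omega>))\<^sup>2)"
    using assms by (simp add: L2_integrable)
  then have "integrable N (\<lambda>\<omega>. (norm (T (X \<omega>)))\<^sup>2)"
    by (rule Bochner_Integration.integrable_bound) (auto intro!: AE_I2 norm_sq_measurable m le)
  with m show ?thesis by (simp add: L2_def)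
qed

lemma L2_diff:
  fixes X Y :: "'w \<Rightarrow> 'a"
  assumes "L2 N X" "L2 N Y"
  shows "L2 N (\<lambda>\<omega>. X \<omega> - Y \<omega>)"
  using L2_add[OF assms(1) L2_bounded_linear[OF assms(2) bounded_linear_minus[OF bounded_linear_ident]]]
  by simp

lemma L2_indicator:
  fixes X :: "'w \<Rightarrow> 'a"
  assumes "L2 N X" "A \<in> sets N"
  shows "L2 N (\<lambda>\<omega>. indicator A \<omega> *\<^sub>R X \<omega>)"
proof -
  have m: "(\<lambda>\<omega>. indicator A \<omega> *\<^sub>R X \<omega>) \<in> borel_measurable N"
    using assms by (intro scaleR_measurable borel_measurable_indicator L2_measurable)
  have "integrable N (\<lambda>\<omega>. (norm (indicator A \<omega> *\<^sub>R X \<omega>))\<^sup>2)"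
    by (rule Bochner_Integration.integrable_bound[OF L2_integrable[OF assms(1)]])
      (auto intro!: AE_I2 norm_sq_measurable m simp del: norm_scaleR, simp add: indicator_def)
  with m show ?thesis by (simp add: L2_def)
qed

lemma L2_sum:
  fixes X :: "'i \<Rightarrow> 'w \<Rightarrow> 'a"
  assumes "finite I" "\<And>i. i \<in> I \<Longrightarrow> L2 N (X i)"
  shows "L2 N (\<lambda>\<omega>. \<Sum>i\<in>I. X i \<omega>)"
  using assms
proof (induction rule: finite_induct)
  case empty
  then show ?case by (simp add: L2_def)
next
  case (insert i I)
  then show ?case by (simp add: L2_add)
qed

lemma integrable_inner:
  fixes X Y :: "'w \<Rightarrow> 'a"
  assumes "L2 N X" "L2 N Y"
  shows "integrable N (\<lambda>\<omega>. inner (X \<omega>) (Y \<omega>))"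
proof (rule Bochner_Integration.integrable_bound)
  show "integrable N (\<lambda>\<omega>. (norm (X \<omega>))\<^sup>2 + (norm (Y \<omega>))\<^sup>2)"
    using assms by (simp add: L2_integrable)
  show "(\<lambda>\<omega>. inner (X \<omega>) (Y \<omega>)) \<in> borel_measurable N"
    by (intro inner_measurable L2_measurable assms)
qed (use abs_inner_le_norm_sq in \<open>auto intro!: AE_I2\<close>)

lemma nn_integral_norm_sq:
  fixes X :: "'w \<Rightarrow> 'a"
  assumes "L2 N X"
  shows "(\<integral>\<^sup>+\<omega>. ennreal ((norm (X \<omega>))\<^sup>2) \<partial>N) = ennreal (\<integral>\<omega>. (norm (X \<omega>))\<^sup>2 \<partial>N)"
  using L2_integrable[OF assms] by (rule nn_integral_eq_integral) simp

text \<open>Orthogonality is expressed through second moments alone, for which limits are available.\<close>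
lemma pythagoras_iff_orthogonal:
  fixes X Y :: "'w \<Rightarrow> 'a"
  assumes "L2 N X" "L2 N Y"
  shows "(\<integral>\<^sup>+\<omega>. ennreal ((norm (X \<omega> + Y \<omega>))\<^sup>2) \<partial>N) =
      (\<integral>\<^sup>+\<omega>. ennreal ((norm (X \<omega>))\<^sup>2) \<partial>N) + (\<integral>\<^sup>+\<omega>. ennreal ((norm (Y \<omega>))\<^sup>2) \<partial>N)
    \<longleftrightarrow> (\<integral>\<omega>. inner (X \<omega>) (Y \<omega>) \<partial>N) = 0"
proof -
  have "(norm (X \<omega> + Y \<omega>))\<^sup>2 = (norm (X \<omega>))\<^sup>2 + (norm (Y \<omega>))\<^sup>2 + 2 * inner (X \<omega>) (Y \<omega>)" for \<omega>
    unfolding power2_norm_eq_inner by (simp add: inner_simps inner_commute)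
  then have "(\<integral>\<omega>. (norm (X \<omega> + Y \<omega>))\<^sup>2 \<partial>N) = (\<integral>\<omega>. (norm (X \<omega>))\<^sup>2 \<partial>N) +
      (\<integral>\<omega>. (norm (Y \<omega>))\<^sup>2 \<partial>N) + 2 * (\<integral>\<omega>. inner (X \<omega>) (Y \<omega>) \<partial>N)"
    using assms by (simp add: L2_integrable integrable_inner)
  moreover have "0 \<le> (\<integral>\<omega>. (norm (X \<omega> + Y \<omega>))\<^sup>2 \<partial>N)" "0 \<le> (\<integral>\<omega>. (norm (X \<omega>))\<^sup>2 \<partial>N)"
    "0 \<le> (\<integral>\<omega>. (norm (Y \<omega>))\<^sup>2 \<partial>N)" by simp_all
  ultimately show ?thesis
    by (simp add: nn_integral_norm_sq assms L2_add flip: ennreal_plus)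
qed

lemma L2_limit_norm_sq:
  fixes X :: "nat \<Rightarrow> 'w \<Rightarrow> 'a"
  assumes X: "\<And>n. X n \<in> borel_measurable N" and Y: "Y \<in> borel_measurable N"
    and lim: "(\<lambda>n. \<integral>\<^sup>+\<omega>. ennreal ((norm (X n \<omega> - Y \<omega>))\<^sup>2) \<partial>N) \<longlonglongrightarrow> 0"
  shows "(\<lambda>n. \<integral>\<^sup>+\<omega>. ennreal ((norm (X n \<omega>))\<^sup>2) \<partial>N) \<longlonglongrightarrow> (\<integral>\<^sup>+\<omega>. ennreal ((norm (Y \<omega>))\<^sup>2) \<partial>N)"
proof (rule tendsto_quasi_triangle[OF _ _ lim])
  have split: "(\<integral>\<^sup>+\<omega>. ennreal a * ennreal ((norm (V \<omega>))\<^sup>2) + ennreal c * ennreal ((norm (W \<omega>))\<^sup>2) \<partial>N) =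
      ennreal a * (\<integral>\<^sup>+\<omega>. ennreal ((norm (V \<omega>))\<^sup>2) \<partial>N) + ennreal c * (\<integral>\<^sup>+\<omega>. ennreal ((norm (W \<omega>))\<^sup>2) \<partial>N)"
    if "V \<in> borel_measurable N" "W \<in> borel_measurable N" for a c and V W :: "'w \<Rightarrow> 'a"
  proof -
    note [measurable] = norm_sq_measurable[OF that(1)] norm_sq_measurable[OF that(2)]
    show ?thesis by (simp add: nn_integral_add nn_integral_cmult)
  qed
  fix n :: nat and \<delta> :: real assume \<delta>: "\<delta> > 0"
  have "(\<integral>\<^sup>+\<omega>. ennreal ((norm (X n \<omega>))\<^sup>2) \<partial>N) \<le> (\<integral>\<^sup>+\<omega>. ennreal (1 + \<delta>) * ennreal ((norm (Y \<omega>))\<^sup>2)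
      + ennreal (1 + 1 / \<delta>) * ennreal ((norm (X n \<omega> - Y \<omega>))\<^sup>2) \<partial>N)"
    by (intro nn_integral_mono norm_sq_quasi_triangle \<delta>)
  then show "(\<integral>\<^sup>+\<omega>. ennreal ((norm (X n \<omega>))\<^sup>2) \<partial>N) \<le> ennreal (1 + \<delta>) * (\<integral>\<^sup>+\<omega>. ennreal ((norm (Y \<omega>))\<^sup>2) \<partial>N)
      + ennreal (1 + 1 / \<delta>) * (\<integral>\<^sup>+\<omega>. ennreal ((norm (X n \<omega> - Y \<omega>))\<^sup>2) \<partial>N)"
    by (simp only: split X Y diff_measurable[OF X Y])
  have "(\<integral>\<^sup>+\<omega>. ennreal ((norm (Y \<omega>))\<^sup>2) \<partial>N) \<le> (\<integral>\<^sup>+\<omega>. ennreal (1 + \<delta>) * ennreal ((norm (X n \<omega>))\<^sup>2)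
      + ennreal (1 + 1 / \<delta>) * ennreal ((norm (X n \<omega> - Y \<omega>))\<^sup>2) \<partial>N)"
    by (intro nn_integral_mono) (subst norm_minus_commute, rule norm_sq_quasi_triangle[OF \<delta>])
  then show "(\<integral>\<^sup>+\<omega>. ennreal ((norm (Y \<omega>))\<^sup>2) \<partial>N) \<le> ennreal (1 + \<delta>) * (\<integral>\<^sup>+\<omega>. ennreal ((norm (X n \<omega>))\<^sup>2) \<partial>N)
      + ennreal (1 + 1 / \<delta>) * (\<integral>\<^sup>+\<omega>. ennreal ((norm (X n \<omega> - Y \<omega>))\<^sup>2) \<partial>N)"
    by (simp only: split X Y diff_measurable[OF X Y])
qed

lemma L2_limit_closed:
  fixes X :: "nat \<Rightarrow> 'w \<Rightarrow> 'a"
  assumes X: "\<And>n. L2 N (X n)" and Y: "Y \<in> borel_measurable N"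
    and lim: "(\<lambda>n. \<integral>\<^sup>+\<omega>. ennreal ((norm (X n \<omega> - Y \<omega>))\<^sup>2) \<partial>N) \<longlonglongrightarrow> 0"
  shows "L2 N Y"
proof -
  have "eventually (\<lambda>n. (\<integral>\<^sup>+\<omega>. ennreal ((norm (X n \<omega> - Y \<omega>))\<^sup>2) \<partial>N) < \<infinity>) sequentially"
    using lim by (rule order_tendstoD(2)) simp
  then obtain n where "(\<integral>\<^sup>+\<omega>. ennreal ((norm (X n \<omega> - Y \<omega>))\<^sup>2) \<partial>N) < \<infinity>"
    by (auto simp: eventually_sequentially)
  then have "L2 N (\<lambda>\<omega>. X n \<omega> - Y \<omega>)"
    using diff_measurable[OF L2_measurable[OF X] Y] by (simp add: L2_iff_nn_integral)
  from L2_diff[OF X[of n] this] show ?thesis by simp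
qed

text \<open>Pythagoras' identity for \<open>Z\<close> and \<open>X n\<close> passes to the limit by \<open>L2_limit_norm_sq\<close>.\<close>
lemma L2_limit_orthogonal:
  fixes X :: "nat \<Rightarrow> 'w \<Rightarrow> 'a"
  assumes X: "\<And>n. L2 N (X n)" and Y: "L2 N Y" and Z: "L2 N Z"
    and lim: "(\<lambda>n. \<integral>\<^sup>+\<omega>. ennreal ((norm (X n \<omega> - Y \<omega>))\<^sup>2) \<partial>N) \<longlonglongrightarrow> 0"
    and orth: "\<And>n. (\<integral>\<omega>. inner (Z \<omega>) (X n \<omega>) \<partial>N) = 0"
  shows "(\<integral>\<omega>. inner (Z \<omega>) (Y \<omega>) \<partial>N) = 0"
proof -
  let ?sq = "\<lambda>V. \<integral>\<^sup>+\<omega>. ennreal ((norm (V \<omega> :: 'a))\<^sup>2) \<partial>N"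
  have "(\<lambda>n. ?sq (\<lambda>\<omega>. Z \<omega> + X n \<omega>)) \<longlonglongrightarrow> ?sq (\<lambda>\<omega>. Z \<omega> + Y \<omega>)"
    using lim by (intro L2_limit_norm_sq L2_measurable L2_add X Y Z) simp
  moreover have "?sq (\<lambda>\<omega>. Z \<omega> + X n \<omega>) = ?sq Z + ?sq (X n)" for n
    using orth pythagoras_iff_orthogonal[OF Z X] by blast
  moreover have "(\<lambda>n. ?sq Z + ?sq (X n)) \<longlonglongrightarrow> ?sq Z + ?sq Y"
    using lim by (intro tendsto_add tendsto_const L2_limit_norm_sq L2_measurable X Y)
  ultimately have "?sq (\<lambda>\<omega>. Z \<omega> + Y \<omega>) = ?sq Z + ?sq Y"
    using LIMSEQ_unique by (metis (no_types, lifting) ext)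
  then show ?thesis using pythagoras_iff_orthogonal[OF Z Y] by blast
qed

end

section \<open>Independence and random series\<close>

locale hilbert_prob_space = prob_space M + hilbert_basis e
  for M :: "'w measure" and e :: "nat \<Rightarrow> 'a::real_inner"
begin

lemma indep_var_of_indep_set:
  fixes X :: "'w \<Rightarrow> real" and g :: "'a \<Rightarrow> real"
  assumes sub: "subalgebra M G" and X: "X \<in> borel_measurable G"
    and Y: "Y \<in> borel_measurable M" and g: "g \<in> borel_measurable borel"
    and indep: "indep_set (sets G) (sets (vimage_algebra (space M) Y borel))"
  shows "indep_var borel X borel (\<lambda>\<omega>. g (Y \<omega>))"
proof -
  have sp: "space G = space M" using sub by (simp add: subalgebra_def)
  have *: "sigma_sets (space M) {X -` A \<inter> space M | A. A \<in> sets borel} \<subseteq> sets G"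
  proof (rule sets.sigma_sets_subset'[of _ G, unfolded sp])
    show "{X -` A \<inter> space M | A. A \<in> sets borel} \<subseteq> sets G"
      using measurable_sets[OF X] by (auto simp: sp)
    show "space M \<in> sets G" using sets.top[of G] by (simp add: sp)
  qed
  have Ym: "(\<lambda>\<omega>. g (Y \<omega>)) \<in> borel_measurable (vimage_algebra (space M) Y borel)"
    by (rule measurable_compose[OF measurable_vimage_algebra1 g]) simp
  have **: "sigma_sets (space M) {(\<lambda>\<omega>. g (Y \<omega>)) -` A \<inter> space M | A. A \<in> sets borel}
      \<subseteq> sets (vimage_algebra (space M) Y borel)"
  proof (rule sets.sigma_sets_subset'[of _ "vimage_algebra (space M) Y borel", unfolded space_vimage_algebra])
    show "{(\<lambda>\<omega>. g (Y \<omega>)) -` A \<inter> space M | A. A \<in> sets borel} \<subseteq> sets (vimage_algebra (space M) Y borel)"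
      using measurable_sets[OF Ym] by auto
    show "space M \<in> sets (vimage_algebra (space M) Y borel)"
      using sets.top[of "vimage_algebra (space M) Y borel"] by simp
  qed
  have "indep_set (sigma_sets (space M) {X -` A \<inter> space M | A. A \<in> sets borel})
      (sigma_sets (space M) {(\<lambda>\<omega>. g (Y \<omega>)) -` A \<inter> space M | A. A \<in> sets borel})"
    using indep * ** unfolding indep_sets2_eq by blast
  moreover have "X \<in> borel_measurable M" by (rule measurable_from_subalg[OF sub X])
  ultimately show ?thesis
    using measurable_compose[OF Y g] by (simp add: indep_var_eq)
qed

text \<open>The coordinates of \<open>X\<close> are independent of those of \<open>Y\<close>, and the latter have mean zero. So the claim
  holds for \<open>proj n \<circ> X\<close>, and dominated convergence gives it for \<open>X\<close>.\<close>
lemma indep_orthogonal: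
  assumes sub: "subalgebra M G" and XG: "X \<in> borel_measurable G" and X: "L2 M X" and Y: "L2 M Y"
    and indep: "indep_set (sets G) (sets (vimage_algebra (space M) Y borel))"
    and mean: "\<And>v. expectation (\<lambda>\<omega>. inner (Y \<omega>) v) = 0"
  shows "expectation (\<lambda>\<omega>. inner (X \<omega>) (Y \<omega> :: 'a)) = 0"
proof -
  have proj0: "expectation (\<lambda>\<omega>. inner (proj n (X \<omega>)) (Y \<omega>)) = 0" for n
  proof -
    have iX: "integrable M (\<lambda>\<omega>. inner (X \<omega>) (e j))" and iY: "integrable M (\<lambda>\<omega>. inner (Y \<omega>) (e j))" for j
      using integrable_inner[OF X L2_const] integrable_inner[OF Y L2_const] by auto
    have ind: "indep_var borel (\<lambda>\<omega>. inner (X \<omega>) (e j)) borel (\<lambda>\<omega>. inner (Y \<omega>) (e j))" for j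
      by (rule indep_var_of_indep_set[OF sub _ L2_measurable[OF Y] _ indep])
        (auto intro!: inner_const_measurable XG)
    show ?thesis
      by (simp add: inner_proj indep_var_integrable[OF ind iX iY] indep_var_lebesgue_integral[OF ind iX iY] mean)
  qed
  have "(\<lambda>n. expectation (\<lambda>\<omega>. inner (proj n (X \<omega>)) (Y \<omega>))) \<longlonglongrightarrow> expectation (\<lambda>\<omega>. inner (X \<omega>) (Y \<omega>))"
  proof (rule integral_dominated_convergence[where w = "\<lambda>\<omega>. (norm (X \<omega>))\<^sup>2 + (norm (Y \<omega>))\<^sup>2"])
    show "(\<lambda>\<omega>. inner (X \<omega>) (Y \<omega>)) \<in> borel_measurable M"
      by (intro inner_measurable L2_measurable X Y)
    show "(\<lambda>\<omega>. inner (proj n (X \<omega>)) (Y \<omega>)) \<in> borel_measurable M" for n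
      unfolding inner_proj
      by (intro borel_measurable_sum borel_measurable_times inner_const_measurable L2_measurable X Y)
    show "integrable M (\<lambda>\<omega>. (norm (X \<omega>))\<^sup>2 + (norm (Y \<omega>))\<^sup>2)"
      by (intro Bochner_Integration.integrable_add L2_integrable X Y)
    show "AE \<omega> in M. (\<lambda>n. inner (proj n (X \<omega>)) (Y \<omega>)) \<longlonglongrightarrow> inner (X \<omega>) (Y \<omega>)"
      by (intro AE_I2 tendsto_intros proj_tendsto)
    show "AE \<omega> in M. norm (inner (proj n (X \<omega>)) (Y \<omega>)) \<le> (norm (X \<omega>))\<^sup>2 + (norm (Y \<omega>))\<^sup>2" for n
    proof (rule AE_I2)
      fix \<omega>
      have "norm (inner (proj n (X \<omega>)) (Y \<omega>)) \<le> (norm (proj n (X \<omega>)))\<^sup>2 + (norm (Y \<omega>))\<^sup>2"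
        using abs_inner_le_norm_sq by simp
      also have "\<dots> \<le> (norm (X \<omega>))\<^sup>2 + (norm (Y \<omega>))\<^sup>2"
        by (intro add_right_mono power_mono norm_proj_le) auto
      finally show "norm (inner (proj n (X \<omega>)) (Y \<omega>)) \<le> (norm (X \<omega>))\<^sup>2 + (norm (Y \<omega>))\<^sup>2" .
    qed
  qed
  then show ?thesis by (simp add: proj0 LIMSEQ_const_iff)
qed

lemma nn_integral_indep_indicator:
  assumes sub: "subalgebra M G" and A: "A \<in> sets G" and Y: "Y \<in> borel_measurable M"
    and Yint: "integrable M (\<lambda>\<omega>. g (Y \<omega>))" and g: "g \<in> borel_measurable borel" "\<And>y. 0 \<le> g y"
    and indep: "indep_set (sets G) (sets (vimage_algebra (space M) Y borel))"
  shows "(\<integral>\<^sup>+\<omega>. indicator A \<omega> * ennreal (g (Y \<omega> :: 'a)) \<partial>M) = emeasure M A * (\<integral>\<^sup>+\<omega>. ennreal (g (Y \<omega>)) \<partial>M)"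
proof -
  have AM: "A \<in> sets M" using sub A by (auto simp: subalgebra_def)
  have iA: "integrable M (\<lambda>\<omega>. indicator A \<omega> :: real)"
    using AM by (simp add: integrable_indicator_iff less_top[symmetric])
  have ind: "indep_var borel (\<lambda>\<omega>. indicator A \<omega> :: real) borel (\<lambda>\<omega>. g (Y \<omega>))"
    using A by (intro indep_var_of_indep_set[OF sub _ Y g(1) indep]) simp
  have "(\<integral>\<^sup>+\<omega>. indicator A \<omega> * ennreal (g (Y \<omega>)) \<partial>M) = (\<integral>\<^sup>+\<omega>. ennreal (indicator A \<omega> * g (Y \<omega>)) \<partial>M)"
    by (intro nn_integral_cong) (simp split: split_indicator)
  also have "\<dots> = ennreal (expectation (\<lambda>\<omega>. indicator A \<omega> * g (Y \<omega>)))"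
    using indep_var_integrable[OF ind iA Yint] g(2) by (intro nn_integral_eq_integral) auto
  also have "\<dots> = ennreal (prob A * expectation (\<lambda>\<omega>. g (Y \<omega>)))"
    using AM by (simp add: indep_var_lebesgue_integral[OF ind iA Yint])
  also have "\<dots> = emeasure M A * (\<integral>\<^sup>+\<omega>. ennreal (g (Y \<omega>)) \<partial>M)"
    using g(2) by (simp add: nn_integral_eq_integral[OF Yint] emeasure_eq_measure ennreal_mult)
  finally show ?thesis .
qed

text \<open>For the partial sums, both moments come from expanding inner products and inserting the covariances of
  the coefficients. They pass to \<open>Y\<close> because a bounded operator \<open>A\<close> preserves convergence in mean square.\<close>
lemma random_series:
  fixes \<xi> :: "nat \<Rightarrow> 'w \<Rightarrow> real" and g :: "nat \<Rightarrow> 'a" and A :: "'a \<Rightarrow> 'a"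
  assumes \<xi>: "\<And>j. \<xi> j \<in> borel_measurable M" "\<And>j. integrable M (\<lambda>\<omega>. (\<xi> j \<omega>)\<^sup>2)"
    and mean: "\<And>j. expectation (\<xi> j) = 0"
    and cov: "\<And>j k. expectation (\<lambda>\<omega>. \<xi> j \<omega> * \<xi> k \<omega>) = (if j = k then h else 0)"
    and Y: "Y \<in> borel_measurable M"
    and lim: "(\<lambda>n. \<integral>\<^sup>+\<omega>. ennreal ((norm (Y \<omega> - (\<Sum>j<n. \<xi> j \<omega> *\<^sub>R g j)))\<^sup>2) \<partial>M) \<longlonglongrightarrow> 0"
    and A: "bounded_linear A"
  shows "L2 M Y" and "expectation (\<lambda>\<omega>. inner (A (Y \<omega>)) v) = 0"
    and "(\<integral>\<^sup>+\<omega>. ennreal ((norm (A (Y \<omega>)))\<^sup>2) \<partial>M) = ennreal h * (\<Sum>j. ennreal ((norm (A (g j)))\<^sup>2))"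
proof -
  interpret A: bounded_linear A by (rule A)
  define X where "X n \<omega> = (\<Sum>j<n. \<xi> j \<omega> *\<^sub>R g j)" for n \<omega>
  have i\<xi>: "integrable M (\<xi> j)" for j using \<xi> by (rule square_integrable_imp_integrable)
  have i\<xi>\<xi>: "integrable M (\<lambda>\<omega>. \<xi> j \<omega> * \<xi> k \<omega>)" for j k
  proof (rule Bochner_Integration.integrable_bound)
    show "integrable M (\<lambda>\<omega>. (\<xi> j \<omega>)\<^sup>2 + (\<xi> k \<omega>)\<^sup>2)" using \<xi> by simp
    show "AE \<omega> in M. norm (\<xi> j \<omega> * \<xi> k \<omega>) \<le> norm ((\<xi> j \<omega>)\<^sup>2 + (\<xi> k \<omega>)\<^sup>2)"
      using abs_inner_le_norm_sq[of "\<xi> j _" "\<xi> k _"] by (intro AE_I2) simp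
  qed (use \<xi> in simp)
  have "L2 M (\<lambda>\<omega>. \<xi> j \<omega> *\<^sub>R x)" for j and x :: 'a
    using \<xi> by (auto simp: L2_def power_mult_distrib intro!: scaleR_measurable)
  then have X: "L2 M (X n)" for n
    unfolding X_def by (intro L2_sum) auto
  have lim': "(\<lambda>n. \<integral>\<^sup>+\<omega>. ennreal ((norm (X n \<omega> - Y \<omega>))\<^sup>2) \<partial>M) \<longlonglongrightarrow> 0"
    using lim by (simp add: X_def norm_minus_commute)
  show L2Y: "L2 M Y" by (rule L2_limit_closed[OF X Y lim'])
  note AX = L2_bounded_linear[OF X A] and AY = L2_bounded_linear[OF L2Y A]
  have limA: "(\<lambda>n. \<integral>\<^sup>+\<omega>. ennreal ((norm (A (X n \<omega>) - A (Y \<omega>)))\<^sup>2) \<partial>M) \<longlonglongrightarrow> 0"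
  proof -
    obtain K where K: "\<And>x. norm (A x) \<le> norm x * K" using A.bounded by blast
    have le: "ennreal ((norm (A x - A y))\<^sup>2) \<le> ennreal (K\<^sup>2) * ennreal ((norm (x - y))\<^sup>2)" for x y
      using power_mono[OF K[of "x - y"], of 2]
      by (simp add: A.diff power_mult_distrib mult.commute flip: ennreal_mult)
    have "(\<lambda>n. ennreal (K\<^sup>2) * (\<integral>\<^sup>+\<omega>. ennreal ((norm (X n \<omega> - Y \<omega>))\<^sup>2) \<partial>M)) \<longlonglongrightarrow> ennreal (K\<^sup>2) * 0"
      by (intro ennreal_tendsto_cmult lim') simp
    then have "(\<lambda>n. ennreal (K\<^sup>2) * (\<integral>\<^sup>+\<omega>. ennreal ((norm (X n \<omega> - Y \<omega>))\<^sup>2) \<partial>M)) \<longlonglongrightarrow> 0" by simp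
    then show ?thesis
    proof (rule tendsto_sandwich[OF always_eventually always_eventually tendsto_const, rotated 2])
      show "\<forall>n. (\<integral>\<^sup>+\<omega>. ennreal ((norm (A (X n \<omega>) - A (Y \<omega>)))\<^sup>2) \<partial>M) \<le>
          ennreal (K\<^sup>2) * (\<integral>\<^sup>+\<omega>. ennreal ((norm (X n \<omega> - Y \<omega>))\<^sup>2) \<partial>M)"
        by (simp only: nn_integral_mono le flip: nn_integral_cmult[OF norm_sq_measurable_ennreal[OF
            diff_measurable[OF L2_measurable[OF X] Y]]]) simp
    qed simp
  qed
  have "expectation (\<lambda>\<omega>. inner v (A (X n \<omega>))) = 0" for n
    by (simp add: X_def A.sum A.scaleR inner_sum_right i\<xi> mean)
  then have "expectation (\<lambda>\<omega>. inner v (A (Y \<omega>))) = 0"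
    by (rule L2_limit_orthogonal[OF AX AY L2_const limA])
  then show "expectation (\<lambda>\<omega>. inner (A (Y \<omega>)) v) = 0" by (simp add: inner_commute)
  have "0 \<le> expectation (\<lambda>\<omega>. \<xi> 0 \<omega> * \<xi> 0 \<omega>)" by simp
  then have h: "0 \<le> h" by (simp only: cov if_True simp_thms)
  have eq: "(\<integral>\<^sup>+\<omega>. ennreal ((norm (A (X n \<omega>)))\<^sup>2) \<partial>M) = ennreal h * (\<Sum>j<n. ennreal ((norm (A (g j)))\<^sup>2))" for n
  proof -
    have "(norm (A (X n \<omega>)))\<^sup>2 = (\<Sum>j<n. \<Sum>k<n. \<xi> j \<omega> * \<xi> k \<omega> * inner (A (g j)) (A (g k)))" for \<omega>
      unfolding power2_norm_eq_inner X_def A.sum A.scaleR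
      by (simp add: inner_sum_left inner_sum_right sum_distrib_left mult_ac)
        (subst sum.swap, simp add: mult_ac inner_commute)
    then have "expectation (\<lambda>\<omega>. (norm (A (X n \<omega>)))\<^sup>2) =
        (\<Sum>j<n. \<Sum>k<n. (if j = k then h else 0) * inner (A (g j)) (A (g k)))"
      by (simp add: i\<xi>\<xi> cov)
    also have "\<dots> = h * (\<Sum>j<n. (norm (A (g j)))\<^sup>2)"
      by (simp add: if_distrib[of "\<lambda>x. x * _"] sum_distrib_left power2_norm_eq_inner cong: if_cong)
    finally show ?thesis
      using nn_integral_norm_sq[OF AX] h by (simp add: ennreal_mult sum_nonneg)
  qed
  have "(\<lambda>n. \<integral>\<^sup>+\<omega>. ennreal ((norm (A (X n \<omega>)))\<^sup>2) \<partial>M) \<longlonglongrightarrow> ennreal h * (\<Sum>j. ennreal ((norm (A (g j)))\<^sup>2))"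
    unfolding eq by (intro ennreal_tendsto_cmult summable_LIMSEQ) auto
  with L2_limit_norm_sq[OF L2_measurable[OF AX] L2_measurable[OF AY] limA]
  show "(\<integral>\<^sup>+\<omega>. ennreal ((norm (A (Y \<omega>)))\<^sup>2) \<partial>M) = ennreal h * (\<Sum>j. ennreal ((norm (A (g j)))\<^sup>2))"
    by (rule LIMSEQ_unique)
qed

end

section \<open>Mass, multiplication by scalars and the Hilbert--Schmidt norm\<close>

lemma hilbert_basis_if_orthonormal_basis: "orthonormal_basis e \<Longrightarrow> hilbert_basis e"
  by (simp add: orthonormal_basis_def hilbert_basis_def)

lemma mass_eq_norm_sq: "mass u = (norm u)\<^sup>2"
  unfolding power2_norm_eq_inner
  by transfer (simp flip: complex_norm_square add: integral_complex_of_real del: of_real_power)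

lemma mass_scaleC: "mass (c *\<^sub>C u) = (cmod c)\<^sup>2 * mass u"
  by transfer (simp add: norm_mult power_mult_distrib)

lemma norm_scaleC: "norm (c *\<^sub>C u) = cmod c * norm u"
  by (rule power2_eq_imp_eq) (simp_all add: power_mult_distrib mass_scaleC flip: mass_eq_norm_sq)

lemma inner_scaleC_right: "inner u (c *\<^sub>C v) = inner (cnj c *\<^sub>C u) v"
  by transfer (simp add: mult_ac)

lemma bounded_linear_scaleC: "bounded_linear (\<lambda>u. c *\<^sub>C u)"
proof (rule bounded_linear_intro)
  show "c *\<^sub>C (u + v) = c *\<^sub>C u + c *\<^sub>C v" for u v
    by transfer (auto simp: l2_rel_def distrib_left intro!: square_integrable_add square_integrable_mult)
  show "c *\<^sub>C (r *\<^sub>R u) = r *\<^sub>R (c *\<^sub>C u)" for r u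
    by transfer (auto simp: l2_rel_def mult.left_commute intro!: square_integrable_mult)
  show "norm (c *\<^sub>C u) \<le> norm u * cmod c" for u
    by (simp add: norm_scaleC)
qed

lemma hs_norm_sq_basis:
  fixes e :: "nat \<Rightarrow> 'n::finite l2"
  assumes e: "orthonormal_basis e"
  shows "hs_norm_sq T = (\<Sum>j. ennreal ((norm (T (e j)))\<^sup>2))"
proof -
  define f where "f = (SOME e :: nat \<Rightarrow> 'n l2. orthonormal_basis e)"
  have "orthonormal_basis f" unfolding f_def by (rule someI[of orthonormal_basis, OF e])
  then have "hilbert_basis f" by (rule hilbert_basis_if_orthonormal_basis)
  from hilbert_basis.norm_sq_series_basis_independent[OF hilbert_basis_if_orthonormal_basis[OF e] this
      blinfun.bounded_linear_right[of T]]
  show ?thesis by (simp add: hs_norm_sq_def Let_def flip: f_def)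
qed

section \<open>Increments of Brownian motions and of the Wiener process\<close>

lemma (in prob_space) brownian_increment:
  assumes b: "brownian_motion M b" and st: "0 \<le> s" "s \<le> t"
  shows "(\<lambda>\<omega>. b t \<omega> - b s \<omega>) \<in> borel_measurable M"
    and "integrable M (\<lambda>\<omega>. (b t \<omega> - b s \<omega>)\<^sup>2)"
    and "expectation (\<lambda>\<omega>. b t \<omega> - b s \<omega>) = 0"
    and "expectation (\<lambda>\<omega>. (b t \<omega> - b s \<omega>)\<^sup>2) = t - s"
proof -
  have "b r \<in> borel_measurable M" if "0 \<le> r" for r using b that by (simp add: brownian_motion_def)
  then show "(\<lambda>\<omega>. b t \<omega> - b s \<omega>) \<in> borel_measurable M" using st by auto
  have *: "integrable M (\<lambda>\<omega>. (b t \<omega> - b s \<omega>)\<^sup>2) \<and> expectation (\<lambda>\<omega>. b t \<omega> - b s \<omega>) = 0 \<and>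
      expectation (\<lambda>\<omega>. (b t \<omega> - b s \<omega>)\<^sup>2) = t - s"
  \<comment> \<open>increments over intervals of length \<open>0\<close> vanish and have no normal density\<close>
  proof (cases "s = t")
    case False
    then have pos: "0 < sqrt (t - s)" using st by simp
    have D: "distributed M lborel (\<lambda>\<omega>. b t \<omega> - b s \<omega>) (normal_density 0 (sqrt (t - s)))"
      using b st False by (simp add: brownian_motion_def)
    have "integrable lborel (\<lambda>x. normal_density 0 (sqrt (t - s)) x * x\<^sup>2)"
      using integrable_normal_moment[OF pos, of 0 2] by simp
    then have "integrable M (\<lambda>\<omega>. (b t \<omega> - b s \<omega>)\<^sup>2)"
      using distributed_integrable[OF D, of "\<lambda>x. x\<^sup>2"] pos by simp
    moreover have "expectation (\<lambda>\<omega>. b t \<omega> - b s \<omega>) = 0"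
      by (rule normal_distributed_expectation[OF pos D])
    ultimately show ?thesis using normal_distributed_variance[OF pos D] st by simp
  qed simp
  then show "integrable M (\<lambda>\<omega>. (b t \<omega> - b s \<omega>)\<^sup>2)" "expectation (\<lambda>\<omega>. b t \<omega> - b s \<omega>) = 0"
    "expectation (\<lambda>\<omega>. (b t \<omega> - b s \<omega>)\<^sup>2) = t - s" by auto
qed

lemma (in prob_space) brownian_increments_uncorrelated:
  assumes b: "\<And>j. brownian_motion M (b j)"
    and indep: "indep_vars (\<lambda>_::nat. PiM {0..} (\<lambda>_. borel)) (\<lambda>j \<omega>. \<lambda>t\<in>{0..}. b j t \<omega>) UNIV"
    and st: "0 \<le> s" "s \<le> t"
  shows "expectation (\<lambda>\<omega>. (b j t \<omega> - b j s \<omega>) * (b k t \<omega> - b k s \<omega>)) = (if j = k then t - s else 0)"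
proof (cases "j = k")
  case True
  then show ?thesis using brownian_increment(4)[OF b[of k] st] by (simp add: power2_eq_square)
next
  case False
  have "indep_vars (\<lambda>_. borel) (\<lambda>j \<omega>. (\<lambda>p. p t - p s) (\<lambda>t\<in>{0..}. b j t \<omega>)) UNIV"
    using st by (intro indep_vars_compose2[OF indep] borel_measurable_diff measurable_component_singleton) auto
  then have "indep_vars (\<lambda>_. borel) (\<lambda>j \<omega>. b j t \<omega> - b j s \<omega>) UNIV"
    using st by simp
  then have ind: "indep_vars (\<lambda>_. borel) (\<lambda>j \<omega>. b j t \<omega> - b j s \<omega>) {j, k}"
    by (rule indep_vars_subset) simp
  have int: "integrable M (\<lambda>\<omega>. b j t \<omega> - b j s \<omega>)" for j
    using brownian_increment(1,2)[OF b st] by (rule square_integrable_imp_integrable)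
  show ?thesis
    using indep_vars_lebesgue_integral[OF _ ind int] False brownian_increment(3)[OF b st] by simp
qed

lemma L2_cong: "(\<And>\<omega>. \<omega> \<in> space N \<Longrightarrow> X \<omega> = Y \<omega>) \<Longrightarrow> L2 N X \<longleftrightarrow> L2 N Y"
  unfolding L2_def by (intro conj_cong measurable_cong Bochner_Integration.integrable_cong) auto

text \<open>The basis \<open>e\<close> is the coordinate system for measurability and orthogonality arguments. The expansion of
  \<open>W\<close> comes with a basis of its own; \<open>hs_norm_sq_basis\<close> lets the two coexist.\<close>
locale wiener_setting = hilbert_prob_space M e
  for M :: "'w measure" and e :: "nat \<Rightarrow> 'n::finite l2" +
  fixes F :: "real \<Rightarrow> 'w measure" and Q :: "'n l2 \<Rightarrow>\<^sub>L 'n l2" and W :: "real \<Rightarrow> 'w \<Rightarrow> 'n l2"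
  assumes basis: "orthonormal_basis e"
    and filtration: "normal_filtration M F"
    and wiener: "q_wiener_process M F Q W"
begin

lemma subalgebra_F: "0 \<le> t \<Longrightarrow> subalgebra M (F t)"
  using filtration by (simp add: normal_filtration_def)

lemma space_F: "0 \<le> t \<Longrightarrow> space (F t) = space M"
  using subalgebra_F by (auto simp: subalgebra_def)

lemma subalgebra_F_F: "0 \<le> s \<Longrightarrow> s \<le> t \<Longrightarrow> subalgebra (F t) (F s)"
  unfolding subalgebra_def using filtration space_F[of s] space_F[of t]
  by (auto simp only: normal_filtration_def)

lemma W_measurable: "0 \<le> t \<Longrightarrow> W t \<in> borel_measurable (F t)"
  using wiener by (simp add: q_wiener_process_def)

lemma dW_measurable: "0 \<le> s \<Longrightarrow> s \<le> t \<Longrightarrow> (\<lambda>\<omega>. W t \<omega> - W s \<omega>) \<in> borel_measurable (F t)"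
  using W_measurable measurable_from_subalg[OF subalgebra_F_F W_measurable]
  by (intro diff_measurable) auto

lemma dW_indep: "0 \<le> s \<Longrightarrow> s \<le> t \<Longrightarrow>
    indep_set (sets (F s)) (sets (vimage_algebra (space M) (\<lambda>\<omega>. W t \<omega> - W s \<omega>) borel))"
  using wiener by (simp add: q_wiener_process_def)

text \<open>The increment is the mean-square limit of the increments of the expansion of \<open>W\<close>, so that
  \<open>random_series\<close> applies with coefficients of variance \<open>t - s\<close>. The resulting series is a Hilbert--Schmidt
  norm in the basis of that expansion.\<close>
lemma dW_moments:
  assumes st: "0 \<le> s" "s \<le> t"
  shows "L2 M (\<lambda>\<omega>. W t \<omega> - W s \<omega>)"
    and "expectation (\<lambda>\<omega>. inner (blinfun_apply A (W t \<omega> - W s \<omega>)) v) = 0"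
    and "(\<integral>\<^sup>+\<omega>. ennreal ((norm (blinfun_apply A (W t \<omega> - W s \<omega>)))\<^sup>2) \<partial>M) =
      ennreal (t - s) * hs_norm_sq (A o\<^sub>L op_sqrt Q)"
proof -
  obtain f b where f: "orthonormal_basis f" and b: "\<And>j. brownian_motion M (b j)"
    and indep: "indep_vars (\<lambda>_::nat. PiM {0..} (\<lambda>_. borel)) (\<lambda>j \<omega>. \<lambda>t\<in>{0..}. b j t \<omega>) UNIV"
    and conv: "\<And>t. 0 \<le> t \<Longrightarrow> (\<lambda>n. \<integral>\<^sup>+ \<omega>. ennreal ((norm (W t \<omega> - (\<Sum>j<n. b j t \<omega> *\<^sub>R op_sqrt Q (f j))))\<^sup>2) \<partial>M)
           \<longlonglongrightarrow> 0"
    using wiener unfolding q_wiener_process_def by blast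
  let ?g = "\<lambda>j. op_sqrt Q (f j)"
  define V where "V r n \<omega> = W r \<omega> - (\<Sum>j<n. b j r \<omega> *\<^sub>R ?g j)" for r n \<omega>
  have V: "V r n \<in> borel_measurable M" if "0 \<le> r" for r n
    unfolding V_def
    using measurable_from_subalg[OF subalgebra_F W_measurable] b that
    by (intro diff_measurable sum_measurable scaleR_measurable)
      (auto simp: brownian_motion_def)
  have lim: "(\<lambda>n. \<integral>\<^sup>+ \<omega>. ennreal ((norm (W t \<omega> - W s \<omega> - (\<Sum>j<n. (b j t \<omega> - b j s \<omega>) *\<^sub>R ?g j)))\<^sup>2) \<partial>M)
      \<longlonglongrightarrow> 0"
  proof (rule tendsto_sandwich[OF always_eventually always_eventually tendsto_const])
    have "(\<lambda>n. 2 * (\<integral>\<^sup>+ \<omega>. ennreal ((norm (V t n \<omega>))\<^sup>2) \<partial>M) + 2 * (\<integral>\<^sup>+ \<omega>. ennreal ((norm (V s n \<omega>))\<^sup>2) \<partial>M))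
        \<longlonglongrightarrow> 2 * 0 + 2 * 0"
      unfolding V_def using st by (intro tendsto_add ennreal_tendsto_cmult conv) auto
    then show "(\<lambda>n. 2 * (\<integral>\<^sup>+ \<omega>. ennreal ((norm (V t n \<omega>))\<^sup>2) \<partial>M) + 2 * (\<integral>\<^sup>+ \<omega>. ennreal ((norm (V s n \<omega>))\<^sup>2) \<partial>M))
        \<longlonglongrightarrow> 0" by simp
    show "\<forall>n. (\<integral>\<^sup>+ \<omega>. ennreal ((norm (W t \<omega> - W s \<omega> - (\<Sum>j<n. (b j t \<omega> - b j s \<omega>) *\<^sub>R ?g j)))\<^sup>2) \<partial>M)
        \<le> 2 * (\<integral>\<^sup>+ \<omega>. ennreal ((norm (V t n \<omega>))\<^sup>2) \<partial>M) + 2 * (\<integral>\<^sup>+ \<omega>. ennreal ((norm (V s n \<omega>))\<^sup>2) \<partial>M)"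
    proof
      fix n
      note [measurable] = norm_sq_measurable[OF V]
      have eq: "W t \<omega> - W s \<omega> - (\<Sum>j<n. (b j t \<omega> - b j s \<omega>) *\<^sub>R ?g j) = V t n \<omega> + - V s n \<omega>" for \<omega>
        by (simp add: V_def scaleR_diff_left sum_subtractf)
      have "ennreal ((norm (V t n \<omega> + - V s n \<omega>))\<^sup>2) \<le>
          2 * ennreal ((norm (V t n \<omega>))\<^sup>2) + 2 * ennreal ((norm (V s n \<omega>))\<^sup>2)" for \<omega>
        using ennreal_leI[OF norm_sq_add_le[of "V t n \<omega>" "- V s n \<omega>"]]
        by (simp add: ennreal_plus ennreal_mult)
      then have "(\<integral>\<^sup>+ \<omega>. ennreal ((norm (V t n \<omega> + - V s n \<omega>))\<^sup>2) \<partial>M) \<le>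
          (\<integral>\<^sup>+ \<omega>. 2 * ennreal ((norm (V t n \<omega>))\<^sup>2) + 2 * ennreal ((norm (V s n \<omega>))\<^sup>2) \<partial>M)"
        by (intro nn_integral_mono)
      also have "\<dots> = 2 * (\<integral>\<^sup>+ \<omega>. ennreal ((norm (V t n \<omega>))\<^sup>2) \<partial>M) + 2 * (\<integral>\<^sup>+ \<omega>. ennreal ((norm (V s n \<omega>))\<^sup>2) \<partial>M)"
        using st by (simp add: nn_integral_add nn_integral_cmult)
      finally show "(\<integral>\<^sup>+ \<omega>. ennreal ((norm (W t \<omega> - W s \<omega> - (\<Sum>j<n. (b j t \<omega> - b j s \<omega>) *\<^sub>R ?g j)))\<^sup>2) \<partial>M)
        \<le> 2 * (\<integral>\<^sup>+ \<omega>. ennreal ((norm (V t n \<omega>))\<^sup>2) \<partial>M) + 2 * (\<integral>\<^sup>+ \<omega>. ennreal ((norm (V s n \<omega>))\<^sup>2) \<partial>M)"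
        by (simp only: eq)
    qed
  qed simp
  have dW: "(\<lambda>\<omega>. W t \<omega> - W s \<omega>) \<in> borel_measurable M"
    using measurable_from_subalg[OF subalgebra_F dW_measurable] st by auto
  note series = random_series[OF brownian_increment(1,2,3)[OF b st]
      brownian_increments_uncorrelated[OF b indep st] dW lim blinfun.bounded_linear_right]
  show "L2 M (\<lambda>\<omega>. W t \<omega> - W s \<omega>)" by (rule series(1))
  show "expectation (\<lambda>\<omega>. inner (blinfun_apply A (W t \<omega> - W s \<omega>)) v) = 0" by (rule series(2))
  show "(\<integral>\<^sup>+\<omega>. ennreal ((norm (blinfun_apply A (W t \<omega> - W s \<omega>)))\<^sup>2) \<partial>M) =
      ennreal (t - s) * hs_norm_sq (A o\<^sub>L op_sqrt Q)"
    by (simp add: series(3) hs_norm_sq_basis[OF f])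
qed

end

section \<open>The Ito isometry for elementary processes\<close>

lemma hs_norm_sq_zero: "hs_norm_sq 0 = 0"
  by (simp add: hs_norm_sq_def Let_def)

lemma hs_norm_sq_quasi_triangle:
  fixes A B :: "'n::finite l2 \<Rightarrow>\<^sub>L 'n l2"
  assumes \<delta>: "0 < \<delta>"
  shows "hs_norm_sq A \<le> ennreal (1 + \<delta>) * hs_norm_sq B + ennreal (1 + 1 / \<delta>) * hs_norm_sq (A - B)"
proof -
  define f where "f = (SOME e :: nat \<Rightarrow> 'n l2. orthonormal_basis e)"
  have "(\<Sum>j. ennreal ((norm (A (f j)))\<^sup>2)) \<le>
      (\<Sum>j. ennreal (1 + \<delta>) * ennreal ((norm (B (f j)))\<^sup>2) + ennreal (1 + 1 / \<delta>) * ennreal ((norm ((A - B) (f j)))\<^sup>2))"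
    unfolding blinfun.diff_left by (intro suminf_le norm_sq_quasi_triangle \<delta>) auto
  also have "\<dots> = (\<Sum>j. ennreal (1 + \<delta>) * ennreal ((norm (B (f j)))\<^sup>2)) +
      (\<Sum>j. ennreal (1 + 1 / \<delta>) * ennreal ((norm ((A - B) (f j)))\<^sup>2))"
    by (intro suminf_add[symmetric]) auto
  finally show ?thesis by (simp add: hs_norm_sq_def Let_def flip: f_def)
qed

lemma hs_norm_sq_minus_commute: "hs_norm_sq (A - B) = hs_norm_sq (B - A)"
  by (simp add: hs_norm_sq_def Let_def blinfun.diff_left norm_minus_commute)

lemma simple_function_blinfun_apply:
  fixes \<Phi> :: "'w \<Rightarrow> 'a::real_normed_vector \<Rightarrow>\<^sub>L 'b::real_normed_vector"
  assumes "simple_function N \<Phi>"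
  shows "(\<lambda>\<omega>. \<Phi> \<omega> x) \<in> borel_measurable N"
  using simple_function_compose1[OF assms, of "\<lambda>A. A x"] by (rule borel_measurable_simple_function)

text \<open>Splits a function of a random operator with finitely many values into its cases, so that an
  expectation can be computed on each event \<open>\<Phi> = A\<close> with the fixed operator \<open>A\<close>.\<close>
lemma sum_over_simple_values:
  fixes h :: "'b \<Rightarrow> 'c::{semiring_1}"
  assumes "simple_function N \<Phi>" "\<omega> \<in> space N"
  shows "(\<Sum>A\<in>\<Phi> ` space N. indicator (\<Phi> -` {A} \<inter> space N) \<omega> * h A) = h (\<Phi> \<omega>)"
proof -
  have "(\<Sum>A\<in>\<Phi> ` space N. indicator (\<Phi> -` {A} \<inter> space N) \<omega> * h A) =
      (\<Sum>A\<in>\<Phi> ` space N. if A = \<Phi> \<omega> then h A else 0)"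
    using assms(2) by (intro sum.cong) (auto simp: indicator_def)
  also have "\<dots> = h (\<Phi> \<omega>)"
    using assms by (simp add: simple_functionD(1))
  finally show ?thesis .
qed

text \<open>On the event \<open>\<Phi> = A\<close>, which is in \<open>F s\<close>, the vector \<open>Y\<close> is \<open>A\<close> applied to an increment independent of
  \<open>F s\<close>. Hence the moments of \<open>Y\<close> are averages, over the values \<open>A\<close>, of the moments in \<open>dW_moments\<close>, and
  \<open>Y\<close> is orthogonal to everything square integrable that is known at time \<open>s\<close>.\<close>
lemma (in wiener_setting) ito_step:
  fixes \<Phi> :: "'w \<Rightarrow> 'n l2 \<Rightarrow>\<^sub>L 'n l2"
  assumes st: "0 \<le> s" "s \<le> t" and \<Phi>: "simple_function (F s) \<Phi>"
  defines "Y \<equiv> \<lambda>\<omega>. \<Phi> \<omega> (W t \<omega> - W s \<omega>)"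
  shows "Y \<in> borel_measurable (F t)" and "L2 M Y"
    and "X \<in> borel_measurable (F s) \<Longrightarrow> L2 M X \<Longrightarrow> expectation (\<lambda>\<omega>. inner (X \<omega>) (Y \<omega>)) = 0"
    and "(\<integral>\<^sup>+\<omega>. ennreal ((norm (Y \<omega>))\<^sup>2) \<partial>M) =
      ennreal (t - s) * (\<integral>\<^sup>+\<omega>. hs_norm_sq (\<Phi> \<omega> o\<^sub>L op_sqrt Q) \<partial>M)"
proof -
  let ?D = "\<Phi> ` space M" and ?B = "\<lambda>A. \<Phi> -` {A} \<inter> space M" and ?dW = "\<lambda>\<omega>. W t \<omega> - W s \<omega>"
  have t: "0 \<le> t" using st by simp
  have D: "finite ?D" using simple_functionD(1)[OF \<Phi>] st by (simp add: space_F)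
  have Bs: "?B A \<in> sets (F s)" for A using simple_functionD(2)[OF \<Phi>, of "{A}"] st by (simp add: space_F)
  have Bt: "?B A \<in> sets (F t)" for A
    using Bs[of A] subalgebra_F_F[OF st] by (auto simp: subalgebra_def)
  have BM: "?B A \<in> sets M" for A using Bs[of A] subalgebra_F[OF st(1)] by (auto simp: subalgebra_def)
  note by_values = sum_over_simple_values[OF \<Phi>, unfolded space_F[OF st(1)]]
  \<comment> \<open>\<open>Z\<close> is \<open>Y\<close> split according to the value of \<open>\<Phi>\<close>\<close>
  define Z where "Z \<omega> = (\<Sum>A\<in>?D. indicator (?B A) \<omega> *\<^sub>R A (?dW \<omega>))" for \<omega>
  have YZ: "Y \<omega> = Z \<omega>" if "\<omega> \<in> space M" for \<omega>
  proof -
    have "Z \<omega> = (\<Sum>A\<in>?D. if A = \<Phi> \<omega> then A (?dW \<omega>) else 0)"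
      unfolding Z_def using that by (intro sum.cong) (auto simp: indicator_def)
    then show ?thesis using D that by (simp add: Y_def)
  qed
  have AdW: "(\<lambda>\<omega>. A (?dW \<omega>)) \<in> borel_measurable (F t)" for A :: "'n l2 \<Rightarrow>\<^sub>L 'n l2"
    by (rule continuous_measurable[OF dW_measurable[OF st]]) (intro continuous_intros)
  have L2A: "L2 M (\<lambda>\<omega>. A (?dW \<omega>))" for A :: "'n l2 \<Rightarrow>\<^sub>L 'n l2"
    by (rule L2_bounded_linear[OF dW_moments(1)[OF st] blinfun.bounded_linear_right])
  have "Z \<in> borel_measurable (F t)"
    unfolding Z_def by (intro sum_measurable scaleR_measurable borel_measurable_indicator Bt AdW)
  then show "Y \<in> borel_measurable (F t)"
    using YZ by (subst measurable_cong[of _ _ Z]) (simp_all add: space_F[OF t])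
  have "L2 M Z" unfolding Z_def by (intro L2_sum L2_indicator D L2A BM)
  then show L2Y: "L2 M Y" using YZ by (subst L2_cong[of _ _ Z])
  show "expectation (\<lambda>\<omega>. inner (X \<omega>) (Y \<omega>)) = 0" if X: "X \<in> borel_measurable (F s)" "L2 M X"
  proof -
    have 0: "expectation (\<lambda>\<omega>. inner (indicator (?B A) \<omega> *\<^sub>R X \<omega>) (A (?dW \<omega>))) = 0" for A
    proof (rule indep_orthogonal[OF subalgebra_F[OF st(1)] _ L2_indicator[OF X(2) BM] L2A])
      show "(\<lambda>\<omega>. indicator (?B A) \<omega> *\<^sub>R X \<omega>) \<in> borel_measurable (F s)"
        by (intro scaleR_measurable borel_measurable_indicator Bs X)
      have "(\<lambda>\<omega>. A (?dW \<omega>)) \<in> borel_measurable (vimage_algebra (space M) ?dW borel)"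
        by (rule continuous_measurable[OF measurable_vimage_algebra1]) (auto intro!: continuous_intros)
      then have "sets (vimage_algebra (space M) (\<lambda>\<omega>. A (?dW \<omega>)) borel) \<subseteq> sets (vimage_algebra (space M) ?dW borel)"
        using measurable_sets[of "\<lambda>\<omega>. A (?dW \<omega>)" "vimage_algebra (space M) ?dW borel" borel]
        by (auto simp: sets_vimage_algebra2)
      then show "indep_set (sets (F s)) (sets (vimage_algebra (space M) (\<lambda>\<omega>. A (?dW \<omega>)) borel))"
        using dW_indep[OF st] unfolding indep_sets2_eq by blast
    qed (rule dW_moments(2)[OF st])
    have "expectation (\<lambda>\<omega>. inner (X \<omega>) (Y \<omega>)) =
        expectation (\<lambda>\<omega>. \<Sum>A\<in>?D. inner (indicator (?B A) \<omega> *\<^sub>R X \<omega>) (A (?dW \<omega>)))"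
      by (intro Bochner_Integration.integral_cong) (simp_all add: YZ Z_def inner_sum_right)
    also have "\<dots> = (\<Sum>A\<in>?D. expectation (\<lambda>\<omega>. inner (indicator (?B A) \<omega> *\<^sub>R X \<omega>) (A (?dW \<omega>))))"
      by (intro Bochner_Integration.integral_sum integrable_inner L2_indicator X BM L2A)
    finally show ?thesis by (simp only: 0 sum.neutral_const)
  qed
  have "(\<integral>\<^sup>+\<omega>. ennreal ((norm (Y \<omega>))\<^sup>2) \<partial>M) =
      (\<integral>\<^sup>+\<omega>. (\<Sum>A\<in>?D. indicator (?B A) \<omega> * ennreal ((norm (A (?dW \<omega>)))\<^sup>2)) \<partial>M)"
    by (intro nn_integral_cong) (subst by_values, simp_all add: Y_def)
  also have "\<dots> = (\<Sum>A\<in>?D. \<integral>\<^sup>+\<omega>. indicator (?B A) \<omega> * ennreal ((norm (A (?dW \<omega>)))\<^sup>2) \<partial>M)"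
    using BM norm_sq_measurable_ennreal[OF L2_measurable[OF L2A]]
    by (intro nn_integral_sum borel_measurable_times_ennreal borel_measurable_indicator)
  also have "\<dots> = (\<Sum>A\<in>?D. emeasure M (?B A) * (ennreal (t - s) * hs_norm_sq (A o\<^sub>L op_sqrt Q)))"
  proof (rule sum.cong[OF refl])
    fix A :: "'n l2 \<Rightarrow>\<^sub>L 'n l2"
    have "(\<integral>\<^sup>+\<omega>. indicator (?B A) \<omega> * ennreal ((norm (A (?dW \<omega>)))\<^sup>2) \<partial>M) =
        emeasure M (?B A) * (\<integral>\<^sup>+\<omega>. ennreal ((norm (A (?dW \<omega>)))\<^sup>2) \<partial>M)"
      by (rule nn_integral_indep_indicator[OF subalgebra_F[OF st(1)] Bs L2_measurable[OF dW_moments(1)[OF st]]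
            L2_integrable[OF L2A] _ _ dW_indep[OF st]])
        (auto intro!: borel_measurable_continuous_onI continuous_intros)
    then show "(\<integral>\<^sup>+\<omega>. indicator (?B A) \<omega> * ennreal ((norm (A (?dW \<omega>)))\<^sup>2) \<partial>M) =
        emeasure M (?B A) * (ennreal (t - s) * hs_norm_sq (A o\<^sub>L op_sqrt Q))"
      by (simp only: dW_moments(3)[OF st])
  qed
  also have "\<dots> = ennreal (t - s) * (\<Sum>A\<in>?D. hs_norm_sq (A o\<^sub>L op_sqrt Q) * emeasure M (?B A))"
    by (simp add: sum_distrib_left mult_ac)
  also have "(\<Sum>A\<in>?D. hs_norm_sq (A o\<^sub>L op_sqrt Q) * emeasure M (?B A)) =
      (\<integral>\<^sup>+\<omega>. (\<Sum>A\<in>?D. indicator (?B A) \<omega> * hs_norm_sq (A o\<^sub>L op_sqrt Q)) \<partial>M)"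
    using BM by (subst nn_integral_sum) (auto simp: mult.commute[of "indicator _ _"] nn_integral_cmult_indicator)
  also have "\<dots> = (\<integral>\<^sup>+\<omega>. hs_norm_sq (\<Phi> \<omega> o\<^sub>L op_sqrt Q) \<partial>M)"
    by (intro nn_integral_cong) (simp add: by_values)
  finally show "(\<integral>\<^sup>+\<omega>. ennreal ((norm (Y \<omega>))\<^sup>2) \<partial>M) =
      ennreal (t - s) * (\<integral>\<^sup>+\<omega>. hs_norm_sq (\<Phi> \<omega> o\<^sub>L op_sqrt Q) \<partial>M)" .
qed

lemma elementary_process_mono:
  assumes "elementary_process F t N \<tau> \<Phi>" "i \<le> j" "j \<le> N"
  shows "\<tau> i \<le> \<tau> j"
  using assms(2,3)
proof (induction j rule: dec_induct)
  case (step n)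
  then have "\<tau> n \<le> \<tau> (Suc n)" using assms(1) by (simp add: elementary_process_def)
  with step show ?case by simp
qed simp

lemma elementary_process_nonneg:
  assumes "elementary_process F t N \<tau> \<Phi>" "i \<le> N"
  shows "0 \<le> \<tau> i"
  using elementary_process_mono[OF assms(1), of 0 i] assms by (simp add: elementary_process_def)

text \<open>The partial sums of an elementary integral are martingale-like: the next summand is orthogonal to
  the sum \<open>J\<close> of the previous ones, which is \<open>F (\<tau> k)\<close>-measurable. Pythagoras' identity then adds up the
  second moments. Stating the result for every \<open>k \<le> N\<close> makes the induction possible.\<close>
lemma (in wiener_setting) elementary_integral_moments:
  assumes el: "elementary_process F t N \<tau> \<Phi>" and k: "k \<le> N"
  shows "elementary_integral W k \<tau> \<Phi> \<in> borel_measurable (F (\<tau> k))"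
    and "L2 M (elementary_integral W k \<tau> \<Phi>)"
    and "(\<integral>\<^sup>+\<omega>. ennreal ((norm (elementary_integral W k \<tau> \<Phi> \<omega>))\<^sup>2) \<partial>M) =
      (\<Sum>m<k. ennreal (\<tau> (Suc m) - \<tau> m) * (\<integral>\<^sup>+\<omega>. hs_norm_sq (\<Phi> m \<omega> o\<^sub>L op_sqrt Q) \<partial>M))"
    and "X \<in> borel_measurable (F 0) \<Longrightarrow> L2 M X \<Longrightarrow>
      expectation (\<lambda>\<omega>. inner (X \<omega>) (elementary_integral W k \<tau> \<Phi> \<omega>)) = 0"
proof -
  have "elementary_integral W k \<tau> \<Phi> \<in> borel_measurable (F (\<tau> k)) \<and> L2 M (elementary_integral W k \<tau> \<Phi>) \<and>
    (\<integral>\<^sup>+\<omega>. ennreal ((norm (elementary_integral W k \<tau> \<Phi> \<omega>))\<^sup>2) \<partial>M) =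
      (\<Sum>m<k. ennreal (\<tau> (Suc m) - \<tau> m) * (\<integral>\<^sup>+\<omega>. hs_norm_sq (\<Phi> m \<omega> o\<^sub>L op_sqrt Q) \<partial>M)) \<and>
    (X \<in> borel_measurable (F 0) \<longrightarrow> L2 M X \<longrightarrow>
      expectation (\<lambda>\<omega>. inner (X \<omega>) (elementary_integral W k \<tau> \<Phi> \<omega>)) = 0)"
    using k
  proof (induction k)
    case 0
    then show ?case by (simp add: elementary_integral_def[abs_def] L2_const)
  next
    case (Suc k)
    let ?J = "elementary_integral W k \<tau> \<Phi>" and ?Y = "\<lambda>\<omega>. \<Phi> k \<omega> (W (\<tau> (Suc k)) \<omega> - W (\<tau> k) \<omega>)"
    have st: "0 \<le> \<tau> k" "\<tau> k \<le> \<tau> (Suc k)" and \<Phi>: "simple_function (F (\<tau> k)) (\<Phi> k)"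
      using el Suc.prems elementary_process_nonneg[OF el, of k] by (auto simp: elementary_process_def)
    note step = ito_step[OF st \<Phi>]
    have J: "?J \<in> borel_measurable (F (\<tau> k))" "L2 M ?J"
      using Suc by auto
    have eq: "elementary_integral W (Suc k) \<tau> \<Phi> = (\<lambda>\<omega>. ?J \<omega> + ?Y \<omega>)"
      by (simp add: elementary_integral_def fun_eq_iff)
    have "?J \<in> borel_measurable (F (\<tau> (Suc k)))"
      by (rule measurable_from_subalg[OF subalgebra_F_F[OF st] J(1)])
    then have 1: "(\<lambda>\<omega>. ?J \<omega> + ?Y \<omega>) \<in> borel_measurable (F (\<tau> (Suc k)))"
      by (intro add_measurable step(1))
    have 2: "L2 M (\<lambda>\<omega>. ?J \<omega> + ?Y \<omega>)" by (intro L2_add J step(2))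
    have 3: "(\<integral>\<^sup>+\<omega>. ennreal ((norm (?J \<omega> + ?Y \<omega>))\<^sup>2) \<partial>M) =
        (\<integral>\<^sup>+\<omega>. ennreal ((norm (?J \<omega>))\<^sup>2) \<partial>M) + (\<integral>\<^sup>+\<omega>. ennreal ((norm (?Y \<omega>))\<^sup>2) \<partial>M)"
      using pythagoras_iff_orthogonal[OF J(2) step(2)] step(3)[OF J] by blast
    have 4: "expectation (\<lambda>\<omega>. inner (X \<omega>) (?J \<omega> + ?Y \<omega>)) = 0" if X: "X \<in> borel_measurable (F 0)" "L2 M X"
    proof -
      have "X \<in> borel_measurable (F (\<tau> k))"
        by (rule measurable_from_subalg[OF subalgebra_F_F X(1)]) (use st in auto)
      moreover have "expectation (\<lambda>\<omega>. inner (X \<omega>) (?J \<omega>)) = 0" using Suc X by simp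
      ultimately show ?thesis
        using X(2) by (simp add: inner_add_right integrable_inner[OF X(2) J(2)] integrable_inner[OF X(2) step(2)] step(3))
    qed
    show ?case unfolding eq using 1 2 3 4 Suc by (simp add: step(4))
  qed
  then show "elementary_integral W k \<tau> \<Phi> \<in> borel_measurable (F (\<tau> k))"
    "L2 M (elementary_integral W k \<tau> \<Phi>)"
    "(\<integral>\<^sup>+\<omega>. ennreal ((norm (elementary_integral W k \<tau> \<Phi> \<omega>))\<^sup>2) \<partial>M) =
      (\<Sum>m<k. ennreal (\<tau> (Suc m) - \<tau> m) * (\<integral>\<^sup>+\<omega>. hs_norm_sq (\<Phi> m \<omega> o\<^sub>L op_sqrt Q) \<partial>M))"
    "X \<in> borel_measurable (F 0) \<Longrightarrow> L2 M X \<Longrightarrow>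
      expectation (\<lambda>\<omega>. inner (X \<omega>) (elementary_integral W k \<tau> \<Phi> \<omega>)) = 0"
    by blast+
qed

text \<open>The intervals are disjoint because the grid is monotone, so at most one summand is nonzero at \<open>r\<close>.\<close>
lemma hs_norm_sq_elementary_value:
  assumes el: "elementary_process F t N \<tau> \<Phi>"
  shows "hs_norm_sq (elementary_value N \<tau> \<Phi> r \<omega> o\<^sub>L R) =
    (\<Sum>m<N. indicator {\<tau> m<..\<tau> (Suc m)} r * hs_norm_sq (\<Phi> m \<omega> o\<^sub>L R))"
proof (cases "\<exists>k<N. r \<in> {\<tau> k<..\<tau> (Suc k)}")
  case True
  then obtain k where k: "k < N" "r \<in> {\<tau> k<..\<tau> (Suc k)}" by blast
  have ind: "r \<in> {\<tau> m<..\<tau> (Suc m)} \<longleftrightarrow> m = k" if "m < N" for m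
  proof
    assume m: "r \<in> {\<tau> m<..\<tau> (Suc m)}"
    show "m = k"
    proof (rule linorder_cases[of m k])
      assume "m < k"
      then have "\<tau> (Suc m) \<le> \<tau> k" using k by (intro elementary_process_mono[OF el]) auto
      with m k show ?thesis by auto
    next
      assume "k < m"
      then have "\<tau> (Suc k) \<le> \<tau> m" using that by (intro elementary_process_mono[OF el]) auto
      with m k show ?thesis by auto
    qed
  qed (use k in simp)
  have "elementary_value N \<tau> \<Phi> r \<omega> = (\<Sum>m<N. if m = k then \<Phi> m \<omega> else 0)"
    unfolding elementary_value_def by (intro sum.cong) (auto simp: indicator_def ind simp del: greaterThanAtMost_iff)
  moreover have "(\<Sum>m<N. indicator {\<tau> m<..\<tau> (Suc m)} r * hs_norm_sq (\<Phi> m \<omega> o\<^sub>L R)) =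
      (\<Sum>m<N. if m = k then hs_norm_sq (\<Phi> m \<omega> o\<^sub>L R) else 0)"
    by (intro sum.cong) (auto simp: indicator_def ind simp del: greaterThanAtMost_iff)
  ultimately show ?thesis using k(1) by simp
next
  case False
  then have "indicator {\<tau> m<..\<tau> (Suc m)} r = (0::'z::zero_neq_one)" if "m < N" for m
    using that by (auto simp: indicator_def)
  then have "elementary_value N \<tau> \<Phi> r \<omega> = 0"
    "(\<Sum>m<N. indicator {\<tau> m<..\<tau> (Suc m)} r * hs_norm_sq (\<Phi> m \<omega> o\<^sub>L R)) = 0"
    using False by (auto simp: elementary_value_def indicator_def intro!: sum.neutral)
  then show ?thesis by (simp add: hs_norm_sq_zero)
qed

lemma (in wiener_setting) ito_isometry_elementary:
  assumes el: "elementary_process F t N \<tau> \<Phi>"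
  shows "(\<integral>\<^sup>+\<omega>. ennreal ((norm (elementary_integral W N \<tau> \<Phi> \<omega>))\<^sup>2) \<partial>M) =
    (\<integral>\<^sup>+\<omega>. (\<integral>\<^sup>+r\<in>{0..t}. hs_norm_sq (elementary_value N \<tau> \<Phi> r \<omega> o\<^sub>L op_sqrt Q) \<partial>lborel) \<partial>M)"
proof -
  have "(\<integral>\<^sup>+r\<in>{0..t}. hs_norm_sq (elementary_value N \<tau> \<Phi> r \<omega> o\<^sub>L op_sqrt Q) \<partial>lborel) =
      (\<Sum>m<N. ennreal (\<tau> (Suc m) - \<tau> m) * hs_norm_sq (\<Phi> m \<omega> o\<^sub>L op_sqrt Q))" for \<omega>
  proof -
    have inside: "indicator {\<tau> m<..\<tau> (Suc m)} r * indicator {0..t} r = (indicator {\<tau> m<..\<tau> (Suc m)} r :: ennreal)"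
      if "m < N" for m r
      using elementary_process_nonneg[OF el, of m] elementary_process_mono[OF el, of "Suc m" N] that el
      by (auto simp: indicator_def elementary_process_def)
    have "hs_norm_sq (elementary_value N \<tau> \<Phi> r \<omega> o\<^sub>L op_sqrt Q) * indicator {0..t} r =
        (\<Sum>m<N. hs_norm_sq (\<Phi> m \<omega> o\<^sub>L op_sqrt Q) * indicator {\<tau> m<..\<tau> (Suc m)} r)" for r
      unfolding hs_norm_sq_elementary_value[OF el] sum_distrib_right
    proof (intro sum.cong refl)
      fix m assume "m \<in> {..<N}"
      then show "indicator {\<tau> m<..\<tau> (Suc m)} r * hs_norm_sq (\<Phi> m \<omega> o\<^sub>L op_sqrt Q) * indicator {0..t} r =
          hs_norm_sq (\<Phi> m \<omega> o\<^sub>L op_sqrt Q) * indicator {\<tau> m<..\<tau> (Suc m)} r"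
        using inside[of m r] by (metis lessThan_iff mult.assoc mult.commute)
    qed
    then have "(\<integral>\<^sup>+r\<in>{0..t}. hs_norm_sq (elementary_value N \<tau> \<Phi> r \<omega> o\<^sub>L op_sqrt Q) \<partial>lborel) =
        (\<Sum>m<N. hs_norm_sq (\<Phi> m \<omega> o\<^sub>L op_sqrt Q) * emeasure lborel {\<tau> m<..\<tau> (Suc m)})"
      by (simp only:) (subst nn_integral_sum, auto simp: nn_integral_cmult_indicator)
    also have "\<dots> = (\<Sum>m<N. ennreal (\<tau> (Suc m) - \<tau> m) * hs_norm_sq (\<Phi> m \<omega> o\<^sub>L op_sqrt Q))"
      using el by (intro sum.cong) (auto simp: elementary_process_def mult.commute)
    finally show ?thesis .
  qed
  moreover have "(\<lambda>\<omega>. hs_norm_sq (\<Phi> m \<omega> o\<^sub>L op_sqrt Q)) \<in> borel_measurable M" if "m < N" for m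
  proof (rule measurable_from_subalg[OF subalgebra_F])
    show "0 \<le> \<tau> m" using elementary_process_nonneg[OF el] that by simp
    have "simple_function (F (\<tau> m)) (\<Phi> m)" using el that by (simp add: elementary_process_def)
    then show "(\<lambda>\<omega>. hs_norm_sq (\<Phi> m \<omega> o\<^sub>L op_sqrt Q)) \<in> borel_measurable (F (\<tau> m))"
      by (intro borel_measurable_simple_function simple_function_compose1[of _ _ "\<lambda>A. hs_norm_sq (A o\<^sub>L op_sqrt Q)"])
  qed
  ultimately show ?thesis
    by (simp add: elementary_integral_moments(3)[OF el])
      (subst nn_integral_sum, auto simp: nn_integral_cmult)
qed

section \<open>The Ito integral of an isometric integrand\<close>

lemma (in wiener_setting) hs_norm_sq_measurable_pair:
  fixes G :: "real \<Rightarrow> 'n l2 \<Rightarrow>\<^sub>L 'n l2"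
  assumes el: "elementary_process F t N \<tau> \<Phi>" and G: "\<And>x. continuous_on UNIV (\<lambda>r. G r x)"
  shows "(\<lambda>(\<omega>, r). hs_norm_sq ((G r - elementary_value N \<tau> \<Phi> r \<omega>) o\<^sub>L R)) \<in> borel_measurable (M \<Otimes>\<^sub>M lborel)"
proof -
  have \<Phi>: "(\<lambda>p. \<Phi> m (fst p) x) \<in> borel_measurable (M \<Otimes>\<^sub>M lborel)" if "m < N" for m x
  proof (rule measurable_compose[OF measurable_fst], rule measurable_from_subalg[OF subalgebra_F])
    show "0 \<le> \<tau> m" using elementary_process_nonneg[OF el] that by simp
    show "(\<lambda>\<omega>. \<Phi> m \<omega> x) \<in> borel_measurable (F (\<tau> m))"
      using el that by (intro simple_function_blinfun_apply) (simp add: elementary_process_def)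
  qed
  have "(\<lambda>p. (G (snd p) - elementary_value N \<tau> \<Phi> (snd p) (fst p)) x) \<in> borel_measurable (M \<Otimes>\<^sub>M lborel)" for x
    unfolding elementary_value_def blinfun.diff_left blinfun.sum_left blinfun.scaleR_left
  proof (intro diff_measurable sum_measurable scaleR_measurable \<Phi>)
    show "(\<lambda>p. G (snd p) x) \<in> borel_measurable (M \<Otimes>\<^sub>M lborel)"
      by (rule measurable_compose[OF measurable_snd]) (simp add: borel_measurable_continuous_onI G)
  qed auto
  then show ?thesis
    unfolding hs_norm_sq_basis[OF basis] split_beta blinfun_apply_blinfun_compose
    by (intro borel_measurable_suminf_order norm_sq_measurable_ennreal)
qed

text \<open>Convergence of squared norms in \<open>L\<^sup>2(\<Omega> \<times> [0,t]; HS)\<close>. Since \<open>G r\<close> preserves norms, the limit integrand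
  \<open>hs_norm_sq (G r o\<^sub>L R)\<close> is the constant \<open>hs_norm_sq R\<close>.\<close>
lemma (in wiener_setting) isometric_integrand_limit:
  fixes G :: "real \<Rightarrow> 'n l2 \<Rightarrow>\<^sub>L 'n l2"
  assumes el: "\<And>n. elementary_process F t (N n) (\<tau> n) (\<Phi> n)" and t: "0 \<le> t"
    and G: "\<And>x. continuous_on UNIV (\<lambda>r. G r x)" "\<And>r x. norm (G r x) = norm x"
    and lim: "(\<lambda>n. \<integral>\<^sup>+ \<omega>. (\<integral>\<^sup>+ r\<in>{0..t}.
      hs_norm_sq ((G r - elementary_value (N n) (\<tau> n) (\<Phi> n) r \<omega>) o\<^sub>L R) \<partial>lborel) \<partial>M) \<longlonglongrightarrow> 0"
  shows "(\<lambda>n. \<integral>\<^sup>+ \<omega>. (\<integral>\<^sup>+ r\<in>{0..t}. hs_norm_sq (elementary_value (N n) (\<tau> n) (\<Phi> n) r \<omega> o\<^sub>L R) \<partial>lborel) \<partial>M)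
    \<longlonglongrightarrow> ennreal t * hs_norm_sq R"
proof -
  let ?V = "\<lambda>n r \<omega>. elementary_value (N n) (\<tau> n) (\<Phi> n) r \<omega>" and ?P = "M \<Otimes>\<^sub>M lborel"
  define a where "a n = (\<lambda>p. hs_norm_sq (?V n (snd p) (fst p) o\<^sub>L R) * indicator {0..t} (snd p))" for n
  define b where "b = (\<lambda>p::'w \<times> real. hs_norm_sq R * indicator {0..t} (snd p))"
  define d where "d n = (\<lambda>p. hs_norm_sq ((G (snd p) - ?V n (snd p) (fst p)) o\<^sub>L R) * indicator {0..t} (snd p))" for n
  have ind: "(\<lambda>p. indicator {0..t} (snd p) :: ennreal) \<in> borel_measurable ?P" by simp
  have d: "d n \<in> borel_measurable ?P" for n
    unfolding d_def using hs_norm_sq_measurable_pair[OF el[of n] G(1)] ind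
    by (intro borel_measurable_times_ennreal) (simp_all add: split_beta)
  have "hs_norm_sq ((0 - A) o\<^sub>L R) = hs_norm_sq (A o\<^sub>L R)" for A
    by (simp add: hs_norm_sq_def Let_def blinfun.minus_left)
  then have a: "a n \<in> borel_measurable ?P" for n
    \<comment> \<open>the pair lemma with integrand \<open>0\<close>, as the sign does not affect the norm\<close>
    unfolding a_def using hs_norm_sq_measurable_pair[OF el[of n], of "\<lambda>_. 0" R] ind
    by (intro borel_measurable_times_ennreal) (simp_all add: split_beta)
  have b: "b \<in> borel_measurable ?P" unfolding b_def using ind by simp
  have GR: "hs_norm_sq (G r o\<^sub>L R) = hs_norm_sq R" for r
    by (simp add: hs_norm_sq_def G(2))
  have comp: "(G r o\<^sub>L R) - (A o\<^sub>L R) = (G r - A) o\<^sub>L R" for r A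
    by (rule blinfun_eqI) (simp add: blinfun.diff_left)
  have ab: "a n p \<le> ennreal (1 + \<delta>) * b p + ennreal (1 + 1 / \<delta>) * d n p"
    and ba: "b p \<le> ennreal (1 + \<delta>) * a n p + ennreal (1 + 1 / \<delta>) * d n p" if "0 < \<delta>" for \<delta> n p
    using hs_norm_sq_quasi_triangle[OF that, of "?V n (snd p) (fst p) o\<^sub>L R" "G (snd p) o\<^sub>L R"]
      hs_norm_sq_quasi_triangle[OF that, of "G (snd p) o\<^sub>L R" "?V n (snd p) (fst p) o\<^sub>L R"]
    by (simp_all add: GR comp hs_norm_sq_minus_commute[of "?V n (snd p) (fst p) o\<^sub>L R"]
        a_def b_def d_def split: split_indicator)
  have "(\<lambda>n. \<integral>\<^sup>+p. a n p \<partial>?P) \<longlonglongrightarrow> (\<integral>\<^sup>+p. b p \<partial>?P)"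
  proof (rule tendsto_quasi_triangle)
    fix \<delta> :: real and n assume \<delta>: "0 < \<delta>"
    have "(\<integral>\<^sup>+p. a n p \<partial>?P) \<le> (\<integral>\<^sup>+p. ennreal (1 + \<delta>) * b p + ennreal (1 + 1 / \<delta>) * d n p \<partial>?P)"
      by (intro nn_integral_mono ab \<delta>)
    then show "(\<integral>\<^sup>+p. a n p \<partial>?P) \<le> ennreal (1 + \<delta>) * (\<integral>\<^sup>+p. b p \<partial>?P) + ennreal (1 + 1 / \<delta>) * (\<integral>\<^sup>+p. d n p \<partial>?P)"
      using b d[of n] by (simp add: nn_integral_add nn_integral_cmult)
    have "(\<integral>\<^sup>+p. b p \<partial>?P) \<le> (\<integral>\<^sup>+p. ennreal (1 + \<delta>) * a n p + ennreal (1 + 1 / \<delta>) * d n p \<partial>?P)"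
      by (intro nn_integral_mono ba \<delta>)
    then show "(\<integral>\<^sup>+p. b p \<partial>?P) \<le> ennreal (1 + \<delta>) * (\<integral>\<^sup>+p. a n p \<partial>?P) + ennreal (1 + 1 / \<delta>) * (\<integral>\<^sup>+p. d n p \<partial>?P)"
      using a[of n] d[of n] by (simp add: nn_integral_add nn_integral_cmult)
  next
    show "(\<lambda>n. \<integral>\<^sup>+p. d n p \<partial>?P) \<longlonglongrightarrow> 0"
      using lim unfolding lborel.nn_integral_fst[OF d, symmetric] by (simp add: d_def)
  qed
  moreover have "(\<integral>\<^sup>+p. b p \<partial>?P) = ennreal t * hs_norm_sq R"
    unfolding lborel.nn_integral_fst[OF b, symmetric]
    using t by (simp add: b_def nn_integral_cmult_indicator emeasure_space_1 mult.commute)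
  ultimately show ?thesis
    unfolding lborel.nn_integral_fst[OF a, symmetric] by (simp add: a_def)
qed

lemma (in wiener_setting) ito_integral_isometric_integrand:
  fixes G :: "real \<Rightarrow> 'n l2 \<Rightarrow>\<^sub>L 'n l2"
  assumes I: "has_ito_integral M F Q W (\<lambda>r \<omega>. G r) t I" and t: "0 \<le> t"
    and G: "\<And>x. continuous_on UNIV (\<lambda>r. G r x)" "\<And>r x. norm (G r x) = norm x"
  shows "L2 M I"
    and "(\<integral>\<^sup>+\<omega>. ennreal ((norm (I \<omega>))\<^sup>2) \<partial>M) = ennreal t * hs_norm_sq (op_sqrt Q)"
    and "X \<in> borel_measurable (F 0) \<Longrightarrow> L2 M X \<Longrightarrow> expectation (\<lambda>\<omega>. inner (X \<omega>) (I \<omega>)) = 0"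
proof -
  obtain N \<tau> \<Phi> where el: "\<And>n. elementary_process F t (N n) (\<tau> n) (\<Phi> n)"
    and approx: "(\<lambda>n::nat. \<integral>\<^sup>+ \<omega>. (\<integral>\<^sup>+ r\<in>{0..t}.
      hs_norm_sq ((G r - elementary_value (N n) (\<tau> n) (\<Phi> n) r \<omega>) o\<^sub>L op_sqrt Q) \<partial>lborel) \<partial>M) \<longlonglongrightarrow> 0"
    and lim: "(\<lambda>n. \<integral>\<^sup>+ \<omega>. ennreal ((norm (elementary_integral W (N n) (\<tau> n) (\<Phi> n) \<omega> - I \<omega>))\<^sup>2) \<partial>M) \<longlonglongrightarrow> 0"
    and meas: "I \<in> borel_measurable M"
    using I unfolding has_ito_integral_def by blast
  note J = elementary_integral_moments(2)[OF el order_refl]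
  show L2I: "L2 M I" by (rule L2_limit_closed[OF J meas lim])
  from L2_limit_norm_sq[OF L2_measurable[OF J] meas lim] isometric_integrand_limit[OF el t G approx]
  show "(\<integral>\<^sup>+\<omega>. ennreal ((norm (I \<omega>))\<^sup>2) \<partial>M) = ennreal t * hs_norm_sq (op_sqrt Q)"
    unfolding ito_isometry_elementary[OF el] by (rule LIMSEQ_unique)
  show "expectation (\<lambda>\<omega>. inner (X \<omega>) (I \<omega>)) = 0" if X: "X \<in> borel_measurable (F 0)" "L2 M X"
    by (rule L2_limit_orthogonal[OF J L2I X(2) lim elementary_integral_moments(4)[OF el order_refl X]])
qed

section \<open>Growth of the mass of the mild solution\<close>

text \<open>The stochastic convolution is orthogonal in mean to everything square integrable that is known at time
  \<open>0\<close>. The factor \<open>- \<i>\<close> in front of it is moved to the other side of the inner product, where it is absorbed in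
  the \<open>F 0\<close>-measurable vector \<open>\<i> S t u\<^sub>0\<close>; the two unitary factors do not change the norms.\<close>
lemma (in wiener_setting) mild_solution_second_moment:
  assumes S: "schroedinger_group S" and u0: "u\<^sub>0 \<in> borel_measurable (F 0)" "L2 M u\<^sub>0"
    and u: "mild_solution M F Q W S u\<^sub>0 u" and t: "0 \<le> t"
  shows "(\<integral>\<^sup>+\<omega>. ennreal ((norm (u t \<omega>))\<^sup>2) \<partial>M) =
    (\<integral>\<^sup>+\<omega>. ennreal ((norm (u\<^sub>0 \<omega>))\<^sup>2) \<partial>M) + ennreal t * hs_norm_sq (op_sqrt Q)"
proof -
  obtain I where I: "has_ito_integral M F Q W (\<lambda>r \<omega>. S (t - r)) t I"
    and ut: "AE \<omega> in M. u t \<omega> = S t (u\<^sub>0 \<omega>) - \<i> *\<^sub>C I \<omega>"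
    using u t by (auto simp: mild_solution_def)
  have iso: "norm (S r x) = norm x" for r x
    using S by (simp add: norm_eq_sqrt_inner schroedinger_group_def unitary_group_def)
  have "continuous_on UNIV (\<lambda>r. S r x)" for x
    using S by (simp add: schroedinger_group_def unitary_group_def)
  then have cont: "continuous_on UNIV (\<lambda>r. S (t - r) x)" for x
    by (rule continuous_on_compose2) (auto intro!: continuous_intros)
  note ito = ito_integral_isometric_integrand[OF I t cont iso]
  define X where "X \<omega> = S t (u\<^sub>0 \<omega>)" for \<omega>
  define Y where "Y \<omega> = - (\<i> *\<^sub>C I \<omega>)" for \<omega>
  have bl: "bounded_linear (\<lambda>x. \<i> *\<^sub>C S t x)" "bounded_linear (\<lambda>x::'n l2. - (\<i> *\<^sub>C x))"
    by (intro bounded_linear_compose[OF bounded_linear_scaleC] blinfun.bounded_linear_right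
        bounded_linear_minus bounded_linear_scaleC)+
  have X: "L2 M X" unfolding X_def by (rule L2_bounded_linear[OF u0(2) blinfun.bounded_linear_right])
  have Y: "L2 M Y" unfolding Y_def by (rule L2_bounded_linear[OF ito(1) bl(2)])
  have "(\<lambda>\<omega>. \<i> *\<^sub>C S t (u\<^sub>0 \<omega>)) \<in> borel_measurable (F 0)"
    by (rule continuous_measurable[OF u0(1) linear_continuous_on[OF bl(1)]])
  then have "expectation (\<lambda>\<omega>. inner (\<i> *\<^sub>C S t (u\<^sub>0 \<omega>)) (I \<omega>)) = 0"
    by (rule ito(3)[OF _ L2_bounded_linear[OF u0(2) bl(1)]])
  moreover have "inner (X \<omega>) (Y \<omega>) = inner (\<i> *\<^sub>C S t (u\<^sub>0 \<omega>)) (I \<omega>)" for \<omega>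
  proof -
    have "- \<i> *\<^sub>C v = - (\<i> *\<^sub>C v)" for v :: "'n l2"
      by transfer (auto simp: l2_rel_def square_integrable_mult[of _ "- \<i>", simplified])
    then show ?thesis by (simp add: X_def Y_def inner_scaleC_right)
  qed
  ultimately have orth: "expectation (\<lambda>\<omega>. inner (X \<omega>) (Y \<omega>)) = 0" by simp
  have "(\<integral>\<^sup>+\<omega>. ennreal ((norm (u t \<omega>))\<^sup>2) \<partial>M) = (\<integral>\<^sup>+\<omega>. ennreal ((norm (X \<omega> + Y \<omega>))\<^sup>2) \<partial>M)"
    using ut by (intro nn_integral_cong_AE) (auto simp: X_def Y_def)
  also have "\<dots> = (\<integral>\<^sup>+\<omega>. ennreal ((norm (X \<omega>))\<^sup>2) \<partial>M) + (\<integral>\<^sup>+\<omega>. ennreal ((norm (Y \<omega>))\<^sup>2) \<partial>M)"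
    using pythagoras_iff_orthogonal[OF X Y] orth by blast
  also have "\<dots> = (\<integral>\<^sup>+\<omega>. ennreal ((norm (u\<^sub>0 \<omega>))\<^sup>2) \<partial>M) + ennreal t * hs_norm_sq (op_sqrt Q)"
    by (simp add: X_def Y_def iso norm_scaleC ito(2))
  finally show ?thesis .
qed

theorem proposition3p2:
  fixes M :: "'w measure" and F :: "real \<Rightarrow> 'w measure"
    and Q :: "('n::finite) l2 \<Rightarrow>\<^sub>L 'n l2" and W :: "real \<Rightarrow> 'w \<Rightarrow> 'n l2"
    and S :: "real \<Rightarrow> 'n l2 \<Rightarrow>\<^sub>L 'n l2"
    and u\<^sub>0 :: "'w \<Rightarrow> 'n l2" and u :: "real \<Rightarrow> 'w \<Rightarrow> 'n l2"
  assumes "prob_space M" and "normal_filtration M F"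
    and "schroedinger_group S"
    and "nonneg_selfadjoint Q" and "trace_class Q"
    and "q_wiener_process M F Q W"
    and "u\<^sub>0 \<in> borel_measurable (F 0)"
    and "integrable M (\<lambda>\<omega>. mass (u\<^sub>0 \<omega>))"
    and "mild_solution M F Q W S u\<^sub>0 u"
  shows "\<forall>t\<ge>0. integrable M (\<lambda>\<omega>. mass (u t \<omega>)) \<and>
    (LINT \<omega>|M. mass (u t \<omega>)) = (LINT \<omega>|M. (norm (u t \<omega>))\<^sup>2) \<and>
    (LINT \<omega>|M. (norm (u t \<omega>))\<^sup>2) = (LINT \<omega>|M. mass (u\<^sub>0 \<omega>)) + t * op_trace Q"
proof (intro allI impI)
  fix t :: real assume t: "0 \<le> t"
  obtain e :: "nat \<Rightarrow> 'n l2" where e: "orthonormal_basis e"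
    using assms(6) by (auto simp: q_wiener_process_def)
  interpret prob_space M by (rule assms(1))
  interpret hilbert_basis e by (rule hilbert_basis_if_orthonormal_basis[OF e])
  interpret wiener_setting M e F Q W
    using e assms(2,6) by unfold_locales
  have u0: "L2 M u\<^sub>0"
    using measurable_from_subalg[OF subalgebra_F assms(7)] assms(8) by (simp add: L2_def mass_eq_norm_sq)
  have trace: "hs_norm_sq (op_sqrt Q) = ennreal (op_trace Q)" "0 \<le> op_trace Q"
    using assms(5) by (simp_all add: trace_class_def op_trace_def less_top)
  have sq: "(\<integral>\<^sup>+\<omega>. ennreal ((norm (u t \<omega>))\<^sup>2) \<partial>M) =
      ennreal ((LINT \<omega>|M. (norm (u\<^sub>0 \<omega>))\<^sup>2) + t * op_trace Q)"
    using mild_solution_second_moment[OF assms(3,7) u0 assms(9) t] t trace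
    by (simp add: nn_integral_norm_sq[OF u0] ennreal_plus ennreal_mult)
  have "u t \<in> borel_measurable M"
    using assms(9) t measurable_from_subalg[OF subalgebra_F] by (auto simp: mild_solution_def)
  then have ut: "L2 M (u t)" by (simp add: L2_iff_nn_integral sq)
  have "(LINT \<omega>|M. (norm (u t \<omega>))\<^sup>2) = (LINT \<omega>|M. (norm (u\<^sub>0 \<omega>))\<^sup>2) + t * op_trace Q"
    using sq t trace(2) unfolding nn_integral_norm_sq[OF ut] by (subst (asm) ennreal_inj) auto
  then show "integrable M (\<lambda>\<omega>. mass (u t \<omega>)) \<and>
    (LINT \<omega>|M. mass (u t \<omega>)) = (LINT \<omega>|M. (norm (u t \<omega>))\<^sup>2) \<and>
    (LINT \<omega>|M. (norm (u t \<omega>))\<^sup>2) = (LINT \<omega>|M. mass (u\<^sub>0 \<omega>)) + t * op_trace Q"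
    using L2_integrable[OF ut] by (simp add: mass_eq_norm_sq)
qed

end
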